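(* Let $\mathcal{A}_m\subset\Omega_{n_m}$ ($m=1,2,\dots$) be a sequence of monotone events. Then $\{\mathcal{A}_m\}$ is asymptotically noise sensitive if and only if $\lim_{m\to\infty}\tilde\Lambda(\mathcal{A}_m)=0$.
   Context: $\Omega_n=\{0,1\}^n$ carries the uniform probability measure $\mathbf{P}$, with expectation $\mathbf{E}$; an event is a subset $\mathcal{A}\subset\Omega_n$. A function $f:\Omega_n\to\mathbb{R}$ is monotone if $f(x)\le f(y)$ whenever $x_j\le y_j$ for all $j$; an event is monotone if its indicator function $\chi_{\mathcal{A}}$ is monotone. Weighted majority: for weights $\mathbf{w}=(w_1,\dots,w_n)\in[0,1]^n$, $M_{\mathbf{w}}(x_1,\dots,x_n)=\mathrm{sign}\bigl(\sum_{j=1}^n(2x_j-1)w_j\bigr)$, with $\mathrm{sign}(0)=0$. For an event $\mathcal{A}\subset\Omega_n$, $$\tilde\Lambda(\mathcal{A})=\max\bigl\{|\mathbf{E}(\chi_{\mathcal{A}}M_{\mathbf{w}})|:\mathbf{w}\in[0,1]^n\bigr\}.$$ Noise: for $x\in\Omega_n$ and $\epsilon\in(0,1)$, $N_\epsilon(x)$ is the random element of $\Omega_n$ whose coordinates are, independently, $x_j$ with probability $1-\epsilon$ and $1-x_j$ with probability $\epsilon$. Sensitivity gauge: for an event $\mathcal{A}\subset\Omega_n$ and $\delta>0$, let $$\gamma(\mathcal{A},\epsilon,\delta)=\mathbf{P}\Bigl\{x\in\Omega_n:\bigl|\mathbf{P}(N_\epsilon(x)\in\mathcal{A}\mid x)-\mathbf{P}(\mathcal{A})\bigr|>\delta\Bigr\},\qquad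 \phi(\mathcal{A},\epsilon)=\inf\{\delta>0:\gamma(\mathcal{A},\epsilon,\delta)<\delta\}.$$ A sequence of events $\mathcal{A}_m\subset\Omega_{n_m}$ is asymptotically noise sensitive if $\lim_{m\to\infty}\phi(\mathcal{A}_m,\epsilon)=0$ for every $\epsilon\in(0,1/2)$. *)

theory Defs
  imports "HOL-Probability.Probability"
begin

text \<open>A point of \<open>{0, 1}\<^sup>n\<close> is a function on \<open>{..<n}\<close>, extended by \<^const>\<open>undefined\<close>, with \<^const>\<open>True\<close>
  standing for 1 and \<^const>\<open>False\<close> for 0.\<close>

definition cube :: "nat \<Rightarrow> (nat \<Rightarrow> bool) set" where
  "cube n = (\<Pi>\<^sub>E j\<in>{..<n}. UNIV)"

lemma finite_cube: "finite (cube n)"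
  by (auto simp: cube_def intro!: finite_PiE)

lemma cube_not_empty: "cube n \<noteq> {}"
  by (auto simp: cube_def PiE_eq_empty_iff)

definition unif :: "nat \<Rightarrow> (nat \<Rightarrow> bool) pmf" where
  "unif n = pmf_of_set (cube n)"

definition monotone_fun :: "nat \<Rightarrow> ((nat \<Rightarrow> bool) \<Rightarrow> real) \<Rightarrow> bool" where
  "monotone_fun n f \<longleftrightarrow> monotone_on (cube n) (\<lambda>x y. \<forall>j<n. x j \<le> y j) (\<le>) f"

definition monotone_event :: "nat \<Rightarrow> (nat \<Rightarrow> bool) set \<Rightarrow> bool" where
  "monotone_event n A \<longleftrightarrow> A \<subseteq> cube n \<and> monotone_fun n (indicator A)"

definition weighted_majority :: "nat \<Rightarrow> (nat \<Rightarrow> real) \<Rightarrow> (nat \<Rightarrow> bool) \<Rightarrow> real" where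
  "weighted_majority n w x = sgn (\<Sum>j<n. (2 * of_bool (x j) - 1) * w j)"

definition majority_correlation :: "nat \<Rightarrow> (nat \<Rightarrow> bool) set \<Rightarrow> (nat \<Rightarrow> real) \<Rightarrow> real" where
  "majority_correlation n A w =
     \<bar>measure_pmf.expectation (unif n) (\<lambda>x. indicator A x * weighted_majority n w x)\<bar>"

definition Lambda_tilde :: "nat \<Rightarrow> (nat \<Rightarrow> bool) set \<Rightarrow> real" where
  "Lambda_tilde n A = Max (majority_correlation n A ` (\<Pi>\<^sub>E j\<in>{..<n}. {0..1}))"

text \<open>The maximum is over a finite set of values, because on the finite cube there are only
  finitely many functions with values in \<open>{-1, 0, 1}\<close>.\<close>

lemma finite_majority_correlation: "finite (majority_correlation n A ` W)"
proof -
  let ?r = "\<lambda>w. restrict (weighted_majority n w) (cube n)"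
  let ?c = "\<lambda>g. \<bar>measure_pmf.expectation (unif n) (\<lambda>x. indicator A x * g x)\<bar> :: real"
  have "?r ` W \<subseteq> (\<Pi>\<^sub>E x\<in>cube n. {-1, 0, 1})"
    by (auto simp: weighted_majority_def sgn_if split: if_splits)
  moreover have "finite (\<Pi>\<^sub>E x\<in>cube n. {-1, 0, 1 :: real})"
    by (intro finite_PiE finite_cube) auto
  ultimately have "finite (?c ` ?r ` W)"
    by (blast intro: finite_subset)
  moreover have "majority_correlation n A w = ?c (?r w)" for w
  proof -
    have "measure_pmf.expectation (unif n) (\<lambda>x. indicator A x * weighted_majority n w x)
        = measure_pmf.expectation (unif n) (\<lambda>x. indicator A x * ?r w x)"
      by (rule integral_cong_AE)
         (auto simp: AE_measure_pmf_iff unif_def finite_cube cube_not_empty)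
    then show ?thesis by (simp only: majority_correlation_def)
  qed
  ultimately show ?thesis by (simp add: image_image)
qed

text \<open>The default value \<^const>\<open>undefined\<close> keeps the noisy point in \<^const>\<open>cube\<close>.\<close>

definition noise :: "nat \<Rightarrow> real \<Rightarrow> (nat \<Rightarrow> bool) \<Rightarrow> (nat \<Rightarrow> bool) pmf" where
  "noise n \<epsilon> x =
     Pi_pmf {..<n} undefined (\<lambda>j. map_pmf (\<lambda>flip. if flip then \<not> x j else x j) (bernoulli_pmf \<epsilon>))"

definition gauge_gamma :: "nat \<Rightarrow> (nat \<Rightarrow> bool) set \<Rightarrow> real \<Rightarrow> real \<Rightarrow> real" where
  "gauge_gamma n A \<epsilon> \<delta> = measure_pmf.prob (unif n)
     {x \<in> cube n. \<bar>measure_pmf.prob (noise n \<epsilon> x) A - measure_pmf.prob (unif n) A\<bar> > \<delta>}"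

definition gauge_phi :: "nat \<Rightarrow> (nat \<Rightarrow> bool) set \<Rightarrow> real \<Rightarrow> real" where
  "gauge_phi n A \<epsilon> = Inf {\<delta>. \<delta> > 0 \<and> gauge_gamma n A \<epsilon> \<delta> < \<delta>}"

definition asymptotically_noise_sensitive ::
    "(nat \<Rightarrow> nat) \<Rightarrow> (nat \<Rightarrow> (nat \<Rightarrow> bool) set) \<Rightarrow> bool" where
  "asymptotically_noise_sensitive n A \<longleftrightarrow>
     (\<forall>\<epsilon>\<in>{0<..<1/2}. (\<lambda>m. gauge_phi (n m) (A m) \<epsilon>) \<longlonglongrightarrow> 0)"

end

theory Submission
  imports Defs "HOL-Real_Asymp.Real_Asymp"
begin

text \<open>
  Let \<open>f\<close> be the indicator of an event and \<open>T\<close> the noise operator, which multiplies the Walsh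
  coefficient at \<open>S\<close> by \<open>(1 - 2 * \<epsilon>) ^ card S\<close>.

  Weighted majorities are uniformly stable under noise (Peres): for \<open>\<epsilon> = 1 / m\<close>, applying \<open>T\<close> changes
  them by at most \<open>2 / sqrt m\<close> in \<open>L\<^sup>1\<close>. As \<open>T\<close> is self-adjoint, a correlation of \<open>f\<close> with a
  majority persists as one of \<open>T f\<close>, so \<open>T f\<close> is not close to a constant.

  Conversely, let \<open>f\<close> be monotone with degree-one coefficients \<open>a j\<close>, which are nonnegative. Small
  correlation \<open>\<Lambda>\<close> with all weighted majorities forces \<open>(\<Sum>j<n. (a j)\<^sup>2)\<close> to be \<open>O(\<Lambda>)\<close>, because the linear
  form with weights \<open>a j\<close> is, up to truncation, an average of majorities. Grouping the sets \<open>S\<close>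
  by their largest element \<open>j\<close> and applying hypercontractivity to
  \<open>g j = E (f * spin j | first j coordinates)\<close>, with \<open>\<parallel>g j\<parallel>\<^sub>1 = a j\<close> and
  \<open>(\<Sum>j<n. (\<parallel>g j\<parallel>\<^sub>2)\<^sup>2) \<le> 1\<close>, bounds \<open>\<Sum>S\<noteq>{}. (1 / 3) ^ card S * (fourier n f S)\<^sup>2\<close> by
  \<open>sqrt (\<Sum>j<n. (a j)\<^sup>2)\<close>, so the weight of \<open>f\<close> on each low nonzero level is small.
\<close>

section \<open>Walsh expansion and noise\<close>

text \<open>The uniform expectation as a finite sum, which frees the analysis from integrability
  conditions; \<open>expectation_unif\<close> and \<open>prob_unif\<close> translate.\<close>

definition cube_mean :: "nat \<Rightarrow> ((nat \<Rightarrow> bool) \<Rightarrow> real) \<Rightarrow> real" where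
  "cube_mean n f = (\<Sum>x\<in>cube n. f x) / 2 ^ n"

definition spin :: "(nat \<Rightarrow> bool) \<Rightarrow> nat \<Rightarrow> real" where
  "spin x j = 2 * of_bool (x j) - 1"

definition walsh :: "nat set \<Rightarrow> (nat \<Rightarrow> bool) \<Rightarrow> real" where
  "walsh S x = (\<Prod>j\<in>S. spin x j)"

definition fourier :: "nat \<Rightarrow> ((nat \<Rightarrow> bool) \<Rightarrow> real) \<Rightarrow> nat set \<Rightarrow> real" where
  "fourier n f S = cube_mean n (\<lambda>x. f x * walsh S x)"

text \<open>Parametrised by the multiplier \<open>\<theta>\<close> instead of the flip rate;
  \<open>prob_noise\<close> identifies \<open>\<theta> = 1 - 2 * \<epsilon>\<close> with averaging
  over \<open>noise n \<epsilon> x\<close>.\<close>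

definition noise_op :: "nat \<Rightarrow> real \<Rightarrow> ((nat \<Rightarrow> bool) \<Rightarrow> real) \<Rightarrow> (nat \<Rightarrow> bool) \<Rightarrow> real" where
  "noise_op n \<theta> f x = (\<Sum>S\<in>Pow {..<n}. \<theta> ^ card S * fourier n f S * walsh S x)"

definition flip :: "nat set \<Rightarrow> (nat \<Rightarrow> bool) \<Rightarrow> nat \<Rightarrow> bool" where
  "flip B x = (\<lambda>j. x j \<noteq> (j \<in> B))"

lemma card_cube: "card (cube n) = 2 ^ n"
  by (simp add: cube_def card_PiE)

lemma expectation_unif: "measure_pmf.expectation (unif n) f = cube_mean n f"
  by (simp add: unif_def cube_mean_def integral_pmf_of_set finite_cube cube_not_empty card_cube)

lemma prob_unif: "measure_pmf.prob (unif n) A = cube_mean n (indicator A)"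
  by (subst expectation_unif[symmetric]) simp

lemma cube_mean_add: "cube_mean n (\<lambda>x. f x + g x) = cube_mean n f + cube_mean n g"
  by (simp add: cube_mean_def sum.distrib add_divide_distrib)

lemma cube_mean_diff: "cube_mean n (\<lambda>x. f x - g x) = cube_mean n f - cube_mean n g"
  by (simp add: cube_mean_def sum_subtractf diff_divide_distrib)

lemma cube_mean_uminus: "cube_mean n (\<lambda>x. - f x) = - cube_mean n f"
  by (simp add: cube_mean_def sum_negf)

lemma cube_mean_cmult: "cube_mean n (\<lambda>x. c * f x) = c * cube_mean n f"
  by (simp add: cube_mean_def sum_distrib_left)

lemma cube_mean_multc: "cube_mean n (\<lambda>x. f x * c) = cube_mean n f * c"
  by (simp add: cube_mean_def sum_distrib_right)

lemma cube_mean_sum: "cube_mean n (\<lambda>x. \<Sum>i\<in>I. f i x) = (\<Sum>i\<in>I. cube_mean n (f i))"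
  by (simp add: cube_mean_def sum.swap[of _ I] sum_divide_distrib)

lemma cube_mean_const [simp]: "cube_mean n (\<lambda>x. c) = c"
  by (simp add: cube_mean_def card_cube)

lemma cube_mean_cong: "(\<And>x. x \<in> cube n \<Longrightarrow> f x = g x) \<Longrightarrow> cube_mean n f = cube_mean n g"
  by (simp add: cube_mean_def)

lemma cube_mean_mono: "(\<And>x. x \<in> cube n \<Longrightarrow> f x \<le> g x) \<Longrightarrow> cube_mean n f \<le> cube_mean n g"
  by (simp add: cube_mean_def divide_right_mono sum_mono)

lemma cube_mean_nonneg: "(\<And>x. x \<in> cube n \<Longrightarrow> 0 \<le> f x) \<Longrightarrow> 0 \<le> cube_mean n f"
  by (simp add: cube_mean_def sum_nonneg)

lemma abs_cube_mean_le: "\<bar>cube_mean n f\<bar> \<le> cube_mean n (\<lambda>x. \<bar>f x\<bar>)"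
  by (simp add: cube_mean_def abs_divide divide_right_mono)

lemma cube_mean_Cauchy_Schwarz:
  "(cube_mean n (\<lambda>x. f x * g x))\<^sup>2 \<le> cube_mean n (\<lambda>x. (f x)\<^sup>2) * cube_mean n (\<lambda>x. (g x)\<^sup>2)"
  using Cauchy_Schwarz_ineq_sum[of f g "cube n"]
  by (simp add: cube_mean_def power_divide divide_right_mono power2_eq_square[of "2 ^ n"])

text \<open>Conditioning on the last coordinate, for the induction in
  \<open>hypercontractive_2_4\<close>.\<close>

lemma cube_mean_Suc:
  "cube_mean (Suc n) f =
     (cube_mean n (\<lambda>x. f (x(n := True))) + cube_mean n (\<lambda>x. f (x(n := False)))) / 2"
proof -
  have eq: "cube (Suc n) = (\<lambda>(b, x). x(n := b)) ` (UNIV \<times> cube n)"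
    by (simp add: cube_def lessThan_Suc PiE_insert_eq)
  have inj: "inj_on (\<lambda>(b, x). x(n := b)) (UNIV \<times> cube n)"
    unfolding cube_def by (rule inj_combinator) simp
  have "sum f (cube (Suc n)) = (\<Sum>(b, x)\<in>UNIV \<times> cube n. f (x(n := b)))"
    unfolding eq by (subst sum.reindex[OF inj]) (simp add: case_prod_unfold)
  also have "\<dots> = (\<Sum>x\<in>cube n. f (x(n := True))) + (\<Sum>x\<in>cube n. f (x(n := False)))"
    by (subst sum.cartesian_product[symmetric]) (simp add: UNIV_bool)
  finally show ?thesis
    by (simp add: cube_mean_def add_divide_distrib)
qed

section \<open>Coordinate flips as symmetries of the cube\<close>

lemma flip_in_cube: "B \<subseteq> {..<n} \<Longrightarrow> x \<in> cube n \<Longrightarrow> flip B x \<in> cube n"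
  by (auto simp: cube_def flip_def PiE_iff extensional_def)

lemma flip_flip [simp]: "flip B (flip B x) = x"
  by (auto simp: flip_def)

lemma cube_mean_flip:
  assumes "B \<subseteq> {..<n}"
  shows "cube_mean n (\<lambda>x. f (flip B x)) = cube_mean n f"
proof -
  have "(\<Sum>x\<in>cube n. f (flip B x)) = (\<Sum>x\<in>cube n. f x)"
    by (rule sum.reindex_bij_witness[of _ "flip B" "flip B"])
       (use assms in \<open>auto intro: flip_in_cube\<close>)
  then show ?thesis
    by (simp add: cube_mean_def)
qed

section \<open>Walsh functions: orthonormality, expansion, Parseval\<close>

lemma spin_mult_self [simp]: "spin x j * spin x j = 1"
  by (simp add: spin_def)

lemma spin_flip: "spin (flip B x) j = (if j \<in> B then - 1 else 1) * spin x j"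
  by (auto simp: spin_def flip_def)

lemma walsh_flip: "walsh S (flip B x) = (\<Prod>j\<in>S. if j \<in> B then - 1 else 1) * walsh S x"
  by (simp add: walsh_def spin_flip prod.distrib)

lemma walsh_singleton [simp]: "walsh {j} = (\<lambda>x. spin x j)"
  by (simp add: walsh_def fun_eq_iff)

lemma walsh_empty [simp]: "walsh {} = (\<lambda>x. 1)"
  by (simp add: walsh_def fun_eq_iff)

lemma walsh_square: "walsh S x * walsh S x = 1"
  by (simp add: walsh_def prod.distrib[symmetric])

lemma walsh_flip_singleton:
  "finite S \<Longrightarrow> walsh S (flip {j} x) = (if j \<in> S then - walsh S x else walsh S x)"
proof -
  assume S: "finite S"
  have "(\<Prod>i\<in>S. if i = j then - 1 else 1 :: real) = (if j \<in> S then -1 else 1)"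
    using S by (simp add: prod.delta)
  then show ?thesis by (simp add: walsh_flip)
qed

text \<open>The common source of vanishing means: orthogonality of Walsh functions, balance of
  majorities, and uncorrelated block signs.\<close>

lemma cube_mean_flip_odd:
  assumes "B \<subseteq> {..<n}" "\<And>x. x \<in> cube n \<Longrightarrow> f (flip B x) = - f x"
  shows "cube_mean n f = 0"
proof -
  have "cube_mean n f = cube_mean n (\<lambda>x. - f x)"
    by (subst cube_mean_flip[OF assms(1), symmetric]) (intro cube_mean_cong assms)
  then show ?thesis by (simp add: cube_mean_uminus)
qed

lemma walsh_orthonormal:
  assumes "S \<subseteq> {..<n}" "T \<subseteq> {..<n}"
  shows "cube_mean n (\<lambda>x. walsh S x * walsh T x) = of_bool (S = T)"
proof (cases "S = T")
  case True
  then show ?thesis by (simp add: walsh_square)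
next
  case False
  then obtain j where j: "j \<in> (S - T) \<union> (T - S)" by blast
  have fin: "finite S" "finite T" using assms finite_subset by auto
  have "cube_mean n (\<lambda>x. walsh S x * walsh T x) = 0"
    by (rule cube_mean_flip_odd[of "{j}"]) (use j assms fin in \<open>auto simp: walsh_flip_singleton\<close>)
  then show ?thesis using False by simp
qed

text \<open>The sum over all \<open>S\<close> factors over the coordinates, and a coordinate where
  \<open>x\<close> and \<open>y\<close> differ contributes the factor 0.\<close>

lemma walsh_kernel:
  assumes "x \<in> cube n" "y \<in> cube n"
  shows "(\<Sum>S\<in>Pow {..<n}. walsh S x * walsh S y) = (if x = y then 2 ^ n else 0)"
proof -
  have "(\<Sum>S\<in>Pow {..<n}. walsh S x * walsh S y) = (\<Prod>j<n. spin x j * spin y j + 1)"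
    by (subst prod_add) (simp_all add: walsh_def prod.distrib)
  also have "\<dots> = (if x = y then 2 ^ n else 0)"
  proof (cases "x = y")
    case False
    then obtain j where "x j \<noteq> y j" by blast
    \<comment> \<open>Both points equal \<open>undefined\<close> from \<open>n\<close> on, so they
      can only differ below \<open>n\<close>.\<close>
    moreover from this have "j < n"
      using assms by (metis PiE_arb cube_def lessThan_iff)
    ultimately have "\<exists>j<n. spin x j * spin y j + 1 = 0"
      by (auto simp: spin_def)
    with False show ?thesis by auto
  qed auto
  finally show ?thesis .
qed

lemma walsh_expansion:
  assumes "x \<in> cube n"
  shows "f x = (\<Sum>S\<in>Pow {..<n}. fourier n f S * walsh S x)"
proof -
  have "(\<Sum>S\<in>Pow {..<n}. fourier n f S * walsh S x)
      = (\<Sum>S\<in>Pow {..<n}. \<Sum>y\<in>cube n. f y * (walsh S y * walsh S x)) / 2 ^ n"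
    by (simp add: fourier_def cube_mean_def sum_divide_distrib sum_distrib_right sum_distrib_left mult_ac)
  also have "\<dots> = (\<Sum>y\<in>cube n. f y * (\<Sum>S\<in>Pow {..<n}. walsh S y * walsh S x)) / 2 ^ n"
    by (subst sum.swap) (simp add: sum_distrib_left)
  also have "\<dots> = (\<Sum>y\<in>cube n. if y = x then f y * 2 ^ n else 0) / 2 ^ n"
    by (intro arg_cong2[where f = divide] sum.cong) (simp_all add: walsh_kernel assms)
  also have "\<dots> = f x"
    using assms by (simp add: finite_cube)
  finally show ?thesis by simp
qed

lemma cube_mean_walsh_product:
  "cube_mean n (\<lambda>x. (\<Sum>S\<in>Pow {..<n}. a S * walsh S x) * (\<Sum>S\<in>Pow {..<n}. b S * walsh S x))
     = (\<Sum>S\<in>Pow {..<n}. a S * b S)"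
proof -
  have "cube_mean n (\<lambda>x. (\<Sum>S\<in>Pow {..<n}. a S * walsh S x) * (\<Sum>S\<in>Pow {..<n}. b S * walsh S x))
      = (\<Sum>S\<in>Pow {..<n}. \<Sum>T\<in>Pow {..<n}.
           a S * b T * cube_mean n (\<lambda>x. walsh S x * walsh T x))"
    by (simp add: sum_product cube_mean_sum cube_mean_cmult[symmetric] mult_ac)
  also have "\<dots> = (\<Sum>S\<in>Pow {..<n}. \<Sum>T\<in>Pow {..<n}. if T = S then a S * b T else 0)"
    by (intro sum.cong) (auto simp: walsh_orthonormal)
  finally show ?thesis by simp
qed

lemma Plancherel:
  "cube_mean n (\<lambda>x. f x * g x) = (\<Sum>S\<in>Pow {..<n}. fourier n f S * fourier n g S)"
  by (subst cube_mean_walsh_product[symmetric], rule cube_mean_cong)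
     (simp only: walsh_expansion[symmetric])

lemma Parseval: "cube_mean n (\<lambda>x. (f x)\<^sup>2) = (\<Sum>S\<in>Pow {..<n}. (fourier n f S)\<^sup>2)"
  by (simp add: power2_eq_square Plancherel)

lemma fourier_walsh_sum:
  assumes "T \<subseteq> {..<n}"
  shows "fourier n (\<lambda>x. \<Sum>S\<in>Pow {..<n}. a S * walsh S x) T = a T"
proof -
  have "fourier n (\<lambda>x. \<Sum>S\<in>Pow {..<n}. a S * walsh S x) T
      = (\<Sum>S\<in>Pow {..<n}. a S * cube_mean n (\<lambda>x. walsh S x * walsh T x))"
    by (simp add: fourier_def sum_distrib_right cube_mean_sum cube_mean_cmult[symmetric] mult.assoc)
  also have "\<dots> = (\<Sum>S\<in>Pow {..<n}. if S = T then a S else 0)"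
    using assms by (intro sum.cong) (auto simp: walsh_orthonormal)
  finally show ?thesis using assms by simp
qed

lemma fourier_noise_op:
  "S \<subseteq> {..<n} \<Longrightarrow> fourier n (noise_op n \<theta> f) S = \<theta> ^ card S * fourier n f S"
  unfolding noise_op_def by (rule fourier_walsh_sum)

section \<open>The noise distribution in Walsh coordinates\<close>

lemma pmf_noise:
  assumes "y \<in> cube n" "0 \<le> \<epsilon>" "\<epsilon> \<le> 1"
  shows "pmf (noise n \<epsilon> x) y = (\<Prod>j<n. if y j = x j then 1 - \<epsilon> else \<epsilon>)"
proof -
  have "pmf (map_pmf (\<lambda>flip. if flip then \<not> x j else x j) (bernoulli_pmf \<epsilon>)) b
          = (if b = x j then 1 - \<epsilon> else \<epsilon>)" for j b
  proof -
    \<comment> \<open>Written as an exclusive or with \<open>x j\<close>, the map is injective in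
      the flip, so point masses transfer directly.\<close>
    have eq: "map_pmf (\<lambda>flip. if flip then \<not> x j else x j) (bernoulli_pmf \<epsilon>)
        = map_pmf (\<lambda>flip. flip \<noteq> x j) (bernoulli_pmf \<epsilon>)"
      by (intro map_pmf_cong) auto
    have inj: "inj (\<lambda>flip. flip \<noteq> x j)" by (auto simp: inj_def)
    have "pmf (map_pmf (\<lambda>flip. flip \<noteq> x j) (bernoulli_pmf \<epsilon>)) ((b \<noteq> x j) \<noteq> x j)
        = pmf (bernoulli_pmf \<epsilon>) (b \<noteq> x j)"
      by (rule pmf_map_inj'[OF inj])
    moreover have "((b \<noteq> x j) \<noteq> x j) = b" by auto
    ultimately show ?thesis using assms eq by simp
  qed
  moreover have "y j = undefined" if "j \<ge> n" for j
    using PiE_arb[OF assms(1)[unfolded cube_def], of j] that by simp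
  ultimately show ?thesis
    by (simp add: noise_def pmf_Pi)
qed

lemma set_pmf_noise: "set_pmf (noise n \<epsilon> x) \<subseteq> cube n"
  using set_Pi_pmf_subset[of "{..<n}"]
  by (fastforce simp: noise_def cube_def PiE_iff extensional_def)

text \<open>The noisy coordinates are independent, and each one in \<open>S\<close> contributes
  \<open>(1 - \<epsilon>) - \<epsilon>\<close> times its spin; so Walsh functions are eigenfunctions
  of noise.\<close>

lemma expectation_noise_walsh:
  assumes "S \<subseteq> {..<n}" "0 \<le> \<epsilon>" "\<epsilon> \<le> 1"
  shows "measure_pmf.expectation (noise n \<epsilon> x) (walsh S) = (1 - 2 * \<epsilon>) ^ card S * walsh S x"
proof -
  have W: "walsh S z = (\<Prod>j<n. if j \<in> S then spin z j else 1)" for z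
    using assms(1) by (simp add: walsh_def prod.inter_restrict[symmetric] Int_absorb1)
  have c: "(1 - 2 * \<epsilon>) ^ card S = (\<Prod>j<n. if j \<in> S then 1 - 2 * \<epsilon> else 1)"
    using assms(1) by (simp add: prod.inter_restrict[symmetric] Int_absorb1)
  have "measure_pmf.expectation (noise n \<epsilon> x) (walsh S)
      = (\<Sum>y\<in>cube n. walsh S y * pmf (noise n \<epsilon> x) y)"
    using set_pmf_noise by (intro integral_measure_pmf_real) (auto simp: finite_cube)
  also have "\<dots> = (\<Sum>y\<in>cube n. \<Prod>j<n. (if j \<in> S then 2 * of_bool (y j) - 1 else 1)
                      * (if y j = x j then 1 - \<epsilon> else \<epsilon>))"
    unfolding W spin_def prod.distrib
    by (intro sum.cong refl) (simp only: pmf_noise[OF _ assms(2,3)])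
  also have "\<dots> = (\<Prod>j<n. \<Sum>b\<in>UNIV. (if j \<in> S then 2 * of_bool b - 1 else 1)
                      * (if b = x j then 1 - \<epsilon> else \<epsilon>))"
    unfolding cube_def by (subst prod_sum_PiE) auto
  also have "\<dots> = (1 - 2 * \<epsilon>) ^ card S * walsh S x"
    unfolding c W prod.distrib[symmetric]
    by (intro prod.cong) (auto simp: UNIV_bool spin_def)
  finally show ?thesis .
qed

lemma prob_noise:
  assumes "0 \<le> \<epsilon>" "\<epsilon> \<le> 1"
  shows "measure_pmf.prob (noise n \<epsilon> x) A = noise_op n (1 - 2 * \<epsilon>) (indicator A) x"
proof -
  have fin: "finite (set_pmf (noise n \<epsilon> x))"
    by (rule finite_subset[OF set_pmf_noise finite_cube])
  have "measure_pmf.prob (noise n \<epsilon> x) A = measure_pmf.expectation (noise n \<epsilon> x) (indicator A)"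
    by simp
  also have "\<dots> = measure_pmf.expectation (noise n \<epsilon> x)
                 (\<lambda>y. \<Sum>S\<in>Pow {..<n}. fourier n (indicator A) S * walsh S y)"
    by (rule integral_cong_AE)
       (use set_pmf_noise in \<open>auto simp: AE_measure_pmf_iff intro!: walsh_expansion\<close>)
  also have "\<dots> = (\<Sum>S\<in>Pow {..<n}. fourier n (indicator A) S
                 * measure_pmf.expectation (noise n \<epsilon> x) (walsh S))"
    by (subst Bochner_Integration.integral_sum)
       (auto intro!: integrable_measure_pmf_finite fin)
  also have "\<dots> = noise_op n (1 - 2 * \<epsilon>) (indicator A) x"
    unfolding noise_op_def using assms
    by (intro sum.cong refl) (simp add: expectation_noise_walsh)
  finally show ?thesis .
qed

section \<open>Noise stability of weighted majorities\<close>

text \<open>The operator is diagonal in the Walsh basis, with real multipliers.\<close>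

lemma noise_op_self_adjoint:
  "cube_mean n (\<lambda>x. f x * noise_op n \<theta> g x) = cube_mean n (\<lambda>x. noise_op n \<theta> f x * g x)"
  unfolding Plancherel by (intro sum.cong refl) (simp add: fourier_noise_op)

lemma weighted_majority_spin: "weighted_majority n w x = sgn (\<Sum>j<n. spin x j * w j)"
  by (simp add: weighted_majority_def spin_def)

lemma abs_weighted_majority_le: "\<bar>weighted_majority n w x\<bar> \<le> 1"
  by (simp add: weighted_majority_def abs_sgn_eq)

lemma cube_mean_weighted_majority: "cube_mean n (weighted_majority n w) = 0"
  by (rule cube_mean_flip_odd[of "{..<n}"])
     (simp_all add: weighted_majority_spin spin_flip sum_negf sgn_minus)

text \<open>If the block of each coordinate is chosen independently and uniformly among \<open>m\<close> blocks,
  then flipping the coordinates in any fixed block is noise of rate \<open>1 / m\<close>.\<close>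

lemma noise_op_eq_block_average:
  assumes "x \<in> cube n" "b < m"
  shows "noise_op n (1 - 2 / real m) f x =
    (\<Sum>p\<in>(\<Pi>\<^sub>E j\<in>{..<n}. {..<m}). f (flip {j\<in>{..<n}. p j = b} x)) / real m ^ n"
proof -
  let ?P = "\<Pi>\<^sub>E j\<in>{..<n}. {..<m}"
  let ?B = "\<lambda>p. {j\<in>{..<n}. p j = b}"
  have m: "real m > 0" using assms(2) by simp
  have block: "(\<Sum>p\<in>?P. walsh S (flip (?B p) x)) = real m ^ n * ((1 - 2 / real m) ^ card S * walsh S x)"
    if "S \<subseteq> {..<n}" for S
  proof -
    have "(\<Sum>p\<in>?P. \<Prod>j\<in>S. if j \<in> ?B p then - 1 else 1 :: real)
        = (\<Sum>p\<in>?P. \<Prod>j<n. if j \<in> S then (if p j = b then - 1 else 1) else 1)"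
    proof (rule sum.cong)
      fix p assume "p \<in> ?P"
      have "(\<Prod>j<n. if j \<in> S then (if p j = b then - 1 else 1) else 1)
          = (\<Prod>j\<in>{..<n} \<inter> S. if p j = b then - 1 else 1 :: real)"
        by (simp add: prod.inter_restrict)
      also have "\<dots> = (\<Prod>j\<in>S. if j \<in> ?B p then - 1 else 1)"
        using that by (intro prod.cong) auto
      finally show "(\<Prod>j\<in>S. if j \<in> ?B p then - 1 else 1 :: real)
          = (\<Prod>j<n. if j \<in> S then (if p j = b then - 1 else 1) else 1)" by simp
    qed simp
    also have "\<dots> = (\<Prod>j<n. \<Sum>v<m. if j \<in> S then (if v = b then - 1 else 1) else 1 :: real)"
      by (subst prod_sum_PiE) auto
    also have "\<dots> = (\<Prod>j<n. real m * (if j \<in> S then 1 - 2 / real m else 1))"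
    proof (rule prod.cong)
      \<comment> \<open>One of the \<open>m\<close> labels puts the coordinate in block
        \<open>b\<close> and reverses its sign; the other \<open>m - 1\<close> keep it.\<close>
      have "(\<Sum>v<m. if v = b then - 1 else 1 :: real) = (\<Sum>v<m. 1 - (if v = b then 2 else 0))"
        by (intro sum.cong) auto
      also have "\<dots> = real m - 2"
        using assms(2) by (simp add: sum_subtractf)
      finally have "(\<Sum>v<m. if v = b then - 1 else 1 :: real) = real m - 2" .
      then show "(\<Sum>v<m. if j \<in> S then (if v = b then - 1 else 1) else 1 :: real)
          = real m * (if j \<in> S then 1 - 2 / real m else 1)" for j
        using m by (simp add: right_diff_distrib)
    qed simp
    also have "\<dots> = real m ^ n * (1 - 2 / real m) ^ card S"
      using that by (simp add: prod.distrib prod.inter_restrict[symmetric] Int_absorb1)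
    finally show ?thesis
      by (simp add: walsh_flip sum_distrib_right[symmetric])
  qed
  have "(\<Sum>p\<in>?P. f (flip (?B p) x))
      = (\<Sum>p\<in>?P. \<Sum>S\<in>Pow {..<n}. fourier n f S * walsh S (flip (?B p) x))"
    by (intro sum.cong refl walsh_expansion flip_in_cube assms) auto
  also have "\<dots> = (\<Sum>S\<in>Pow {..<n}. fourier n f S * (\<Sum>p\<in>?P. walsh S (flip (?B p) x)))"
    by (subst sum.swap) (simp add: sum_distrib_left)
  also have "\<dots> = (\<Sum>S\<in>Pow {..<n}. fourier n f S
                    * (real m ^ n * ((1 - 2 / real m) ^ card S * walsh S x)))"
    by (intro sum.cong refl arg_cong2[where f = times] block) simp
  also have "\<dots> = real m ^ n * noise_op n (1 - 2 / real m) f x"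
    by (simp add: noise_op_def sum_distrib_left mult_ac)
  finally show ?thesis using m by simp
qed

text \<open>Peres' argument: changing the sign of one of the block sums \<open>S b\<close> changes the sign of the
  total only in the direction of \<open>S b\<close>, so the total change is a correlation with
  \<open>\<Sum>b<m. sgn (S b)\<close>, a sum of \<open>m\<close> uncorrelated terms.\<close>

lemma weighted_majority_block_sensitivity:
  assumes "disjoint_family_on B {..<m}" and "\<And>b. b < m \<Longrightarrow> B b \<subseteq> {..<n}"
  shows "(\<Sum>b<m. cube_mean n (\<lambda>x. \<bar>weighted_majority n w x - weighted_majority n w (flip (B b) x)\<bar>))
           \<le> 2 * sqrt (real m)"
proof -
  let ?M = "weighted_majority n w"
  define s where "s b x = sgn (\<Sum>j\<in>B b. spin x j * w j)" for b x
  have flip_same: "s b (flip (B b) x) = - s b x" for b x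
    by (simp add: s_def spin_flip sum_negf sgn_minus)
  have flip_other: "s b (flip (B c) x) = s b x" if "b < m" "c < m" "b \<noteq> c" for b c x
  proof -
    have "B b \<inter> B c = {}"
      using assms(1) that by (auto simp: disjoint_family_on_def)
    then show ?thesis
      unfolding s_def by (intro arg_cong[where f = sgn] sum.cong) (auto simp: spin_flip)
  qed
  have single: "cube_mean n (\<lambda>x. \<bar>?M x - ?M (flip (B b) x)\<bar>) = 2 * cube_mean n (\<lambda>x. s b x * ?M x)"
    if "b < m" for b
  proof -
    have "\<bar>?M x - ?M (flip (B b) x)\<bar> = s b x * (?M x - ?M (flip (B b) x))" for x
    proof -
      let ?r = "\<Sum>j\<in>{..<n} - B b. spin x j * w j" and ?S = "\<Sum>j\<in>B b. spin x j * w j"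
      have split: "(\<Sum>j<n. g j) = (\<Sum>j\<in>{..<n} - B b. g j) + (\<Sum>j\<in>B b. g j)" for g :: "nat \<Rightarrow> real"
        using assms(2)[OF that] by (intro sum.subset_diff) auto
      have "?M x = sgn (?r + ?S)"
        by (simp add: weighted_majority_spin split)
      moreover have "?M (flip (B b) x) = sgn (?r - ?S)"
        by (simp add: weighted_majority_spin split spin_flip sum_negf)
      ultimately show ?thesis
        by (auto simp: s_def sgn_if)
    qed
    then have "cube_mean n (\<lambda>x. \<bar>?M x - ?M (flip (B b) x)\<bar>)
        = cube_mean n (\<lambda>x. s b x * ?M x) - cube_mean n (\<lambda>x. s b x * ?M (flip (B b) x))"
      by (simp add: right_diff_distrib cube_mean_diff)
    \<comment> \<open>Substituting \<open>flip (B b) x\<close> for \<open>x\<close> moves the flip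
      onto \<open>s b\<close>, which changes sign under it.\<close>
    also have "cube_mean n (\<lambda>x. s b x * ?M (flip (B b) x)) = - cube_mean n (\<lambda>x. s b x * ?M x)"
      using cube_mean_flip[OF assms(2)[OF that], of "\<lambda>x. s b (flip (B b) x) * ?M x"]
      by (simp add: flip_same cube_mean_uminus)
    finally show ?thesis by simp
  qed
  have orth: "cube_mean n (\<lambda>x. s b x * s c x) \<le> of_bool (b = c)" if "b < m" "c < m" for b c
  proof (cases "b = c")
    case True
    \<comment> \<open>Only an inequality: a block sum can be 0, and then so is its sign.\<close>
    have "cube_mean n (\<lambda>x. s b x * s b x) \<le> cube_mean n (\<lambda>x. 1)"
      by (rule cube_mean_mono) (simp add: s_def sgn_if)
    then show ?thesis using True by simp
  next
    case False
    have "cube_mean n (\<lambda>x. s b x * s c x) = 0"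
      by (rule cube_mean_flip_odd[OF assms(2)[OF that(1)]])
         (use that False in \<open>simp add: flip_same flip_other\<close>)
    then show ?thesis using False by simp
  qed
  have "cube_mean n (\<lambda>x. (\<Sum>b<m. s b x)\<^sup>2) = (\<Sum>b<m. \<Sum>c<m. cube_mean n (\<lambda>x. s b x * s c x))"
    by (simp add: power2_eq_square sum_product cube_mean_sum)
  also have "\<dots> \<le> (\<Sum>b<m. \<Sum>c<m. of_bool (b = c))"
    by (intro sum_mono orth) auto
  also have "\<dots> = real m"
    by (simp add: of_bool_def)
  finally have var: "cube_mean n (\<lambda>x. (\<Sum>b<m. s b x)\<^sup>2) \<le> real m" .
  have "(\<Sum>b<m. cube_mean n (\<lambda>x. \<bar>?M x - ?M (flip (B b) x)\<bar>))
      = 2 * cube_mean n (\<lambda>x. (\<Sum>b<m. s b x) * ?M x)"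
    by (simp add: single sum_distrib_left[symmetric] sum_distrib_right cube_mean_sum)
  also have "cube_mean n (\<lambda>x. (\<Sum>b<m. s b x) * ?M x) \<le> sqrt (real m)"
  proof (rule real_le_rsqrt)
    have "(cube_mean n (\<lambda>x. (\<Sum>b<m. s b x) * ?M x))\<^sup>2
        \<le> cube_mean n (\<lambda>x. (\<Sum>b<m. s b x)\<^sup>2) * cube_mean n (\<lambda>x. (?M x)\<^sup>2)"
      by (rule cube_mean_Cauchy_Schwarz)
    also have "\<dots> \<le> real m * 1"
    proof (intro mult_mono var)
      have "cube_mean n (\<lambda>x. (?M x)\<^sup>2) \<le> cube_mean n (\<lambda>x. 1)"
        by (rule cube_mean_mono) (simp add: abs_square_le_1 abs_weighted_majority_le)
      then show "cube_mean n (\<lambda>x. (?M x)\<^sup>2) \<le> 1" by simp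
    qed (auto intro: cube_mean_nonneg)
    finally show "(cube_mean n (\<lambda>x. (\<Sum>b<m. s b x) * ?M x))\<^sup>2 \<le> real m" by simp
  qed
  finally show ?thesis by simp
qed

text \<open>Each of the \<open>m\<close> blocks of a random partition represents the same noise, so
  \<open>m\<close> times the change is at most the average over partitions of the total block
  sensitivity, \<open>2 * sqrt (real m)\<close>.\<close>

lemma weighted_majority_noise_stable:
  assumes "m > 0"
  shows "cube_mean n (\<lambda>x. \<bar>weighted_majority n w x
           - noise_op n (1 - 2 / real m) (weighted_majority n w) x\<bar>) \<le> 2 / sqrt (real m)"
proof -
  let ?M = "weighted_majority n w" and ?T = "noise_op n (1 - 2 / real m) (weighted_majority n w)"
  let ?P = "\<Pi>\<^sub>E j\<in>{..<n}. {..<m}"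
  let ?B = "\<lambda>p b. {j\<in>{..<n}. p j = b}"
  let ?d = "\<lambda>p b x. \<bar>?M x - ?M (flip (?B p b) x)\<bar>"
  have finP: "finite ?P" by (intro finite_PiE) auto
  have cardP: "real (card ?P) = real m ^ n"
    by (simp add: card_PiE)
  have m: "real m > 0" using assms by simp
  have le: "cube_mean n (\<lambda>x. \<bar>?M x - ?T x\<bar>) \<le> (\<Sum>p\<in>?P. cube_mean n (?d p b)) / real m ^ n"
    if "b < m" for b
  proof -
    have "cube_mean n (\<lambda>x. \<bar>?M x - ?T x\<bar>) \<le> cube_mean n (\<lambda>x. (\<Sum>p\<in>?P. ?d p b x) / real m ^ n)"
    proof (rule cube_mean_mono)
      fix x assume x: "x \<in> cube n"
      have "?M x - ?T x = (\<Sum>p\<in>?P. ?M x - ?M (flip (?B p b) x)) / real m ^ n"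
        using m by (simp add: noise_op_eq_block_average[OF x that] sum_subtractf cardP
          diff_divide_distrib)
      then show "\<bar>?M x - ?T x\<bar> \<le> (\<Sum>p\<in>?P. ?d p b x) / real m ^ n"
        by (simp only: abs_divide) (auto intro!: divide_right_mono sum_abs)
    qed
    also have "\<dots> = (\<Sum>p\<in>?P. cube_mean n (?d p b)) / real m ^ n"
      using cube_mean_multc[of n "\<lambda>x. \<Sum>p\<in>?P. ?d p b x" "1 / real m ^ n"]
      by (simp add: cube_mean_sum)
    finally show ?thesis .
  qed
  have "real m * cube_mean n (\<lambda>x. \<bar>?M x - ?T x\<bar>) = (\<Sum>b<m. cube_mean n (\<lambda>x. \<bar>?M x - ?T x\<bar>))"
    by simp
  also have "\<dots> \<le> (\<Sum>b<m. (\<Sum>p\<in>?P. cube_mean n (?d p b)) / real m ^ n)"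
    by (intro sum_mono le) simp
  also have "\<dots> = (\<Sum>p\<in>?P. \<Sum>b<m. cube_mean n (?d p b)) / real m ^ n"
    by (simp add: sum_divide_distrib[symmetric] sum.swap[of _ "{..<m}"])
  also have "\<dots> \<le> (\<Sum>p\<in>?P. 2 * sqrt (real m)) / real m ^ n"
    by (intro divide_right_mono sum_mono weighted_majority_block_sensitivity)
       (auto simp: disjoint_family_on_def)
  also have "\<dots> = 2 * sqrt (real m)"
    using m by (simp add: cardP)
  also have "\<dots> = real m * (2 / sqrt (real m))"
    using m by (simp add: real_div_sqrt field_simps)
  finally show ?thesis
    by (rule mult_left_le_imp_le) (use m in simp)
qed

text \<open>Write \<open>M = (M - T M) + T M\<close>. Stability bounds the first part, and
  self-adjointness moves \<open>T\<close> onto \<open>f\<close> in the second. The constant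
  \<open>c\<close> can be subtracted because majorities have mean 0.\<close>

lemma weighted_majority_correlation_le:
  assumes "m > 0" and "\<And>x. x \<in> cube n \<Longrightarrow> \<bar>f x\<bar> \<le> 1"
  shows "\<bar>cube_mean n (\<lambda>x. f x * weighted_majority n w x)\<bar>
    \<le> cube_mean n (\<lambda>x. \<bar>noise_op n (1 - 2 / real m) f x - c\<bar>) + 2 / sqrt (real m)"
proof -
  let ?M = "weighted_majority n w" and ?T = "noise_op n (1 - 2 / real m)"
  have "cube_mean n (\<lambda>x. f x * ?M x)
      = cube_mean n (\<lambda>x. f x * (?M x - ?T ?M x)) + cube_mean n (\<lambda>x. (?T f x - c) * ?M x)"
    by (simp add: right_diff_distrib left_diff_distrib cube_mean_diff noise_op_self_adjoint
      cube_mean_cmult cube_mean_weighted_majority)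
  moreover have "\<bar>cube_mean n (\<lambda>x. f x * (?M x - ?T ?M x))\<bar> \<le> 2 / sqrt (real m)"
  proof -
    have "\<bar>cube_mean n (\<lambda>x. f x * (?M x - ?T ?M x))\<bar> \<le> cube_mean n (\<lambda>x. \<bar>f x * (?M x - ?T ?M x)\<bar>)"
      by (rule abs_cube_mean_le)
    also have "\<dots> \<le> cube_mean n (\<lambda>x. \<bar>?M x - ?T ?M x\<bar>)"
      by (intro cube_mean_mono) (simp add: abs_mult assms(2) mult_left_le_one_le)
    also have "\<dots> \<le> 2 / sqrt (real m)"
      by (rule weighted_majority_noise_stable[OF assms(1)])
    finally show ?thesis .
  qed
  moreover have "\<bar>cube_mean n (\<lambda>x. (?T f x - c) * ?M x)\<bar> \<le> cube_mean n (\<lambda>x. \<bar>?T f x - c\<bar>)"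
  proof -
    have "\<bar>cube_mean n (\<lambda>x. (?T f x - c) * ?M x)\<bar> \<le> cube_mean n (\<lambda>x. \<bar>(?T f x - c) * ?M x\<bar>)"
      by (rule abs_cube_mean_le)
    also have "\<dots> \<le> cube_mean n (\<lambda>x. \<bar>?T f x - c\<bar>)"
      by (intro cube_mean_mono) (simp add: abs_mult abs_weighted_majority_le mult_left_le)
    finally show ?thesis .
  qed
  ultimately show ?thesis by linarith
qed

section \<open>Degree-one weight of monotone functions\<close>

lemma monotone_fun_flip:
  assumes "monotone_fun n f" "x \<in> cube n" "i < n"
  shows "\<bar>f x - f (flip {i} x)\<bar> = spin x i * (f x - f (flip {i} x))"
proof -
  have y: "flip {i} x \<in> cube n" using assms by (intro flip_in_cube) auto
  show ?thesis
  proof (cases "x i")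
    case True
    have "f (flip {i} x) \<le> f x"
      using assms(1,2) y True unfolding monotone_fun_def
      by (elim monotone_onD) (auto simp: flip_def)
    with True show ?thesis by (simp add: spin_def)
  next
    case False
    have "f x \<le> f (flip {i} x)"
      using assms(1,2) y False unfolding monotone_fun_def
      by (elim monotone_onD) (auto simp: flip_def)
    with False show ?thesis by (simp add: spin_def)
  qed
qed

text \<open>Monotonicity gives the change the sign of \<open>spin x i\<close>, which replaces the
  absolute value; flip invariance makes the two resulting terms equal up to sign.\<close>

lemma monotone_fun_influence:
  assumes "monotone_fun n f" "i < n"
  shows "cube_mean n (\<lambda>x. \<bar>f x - f (flip {i} x)\<bar>) = 2 * fourier n f {i}"
proof -
  have "cube_mean n (\<lambda>x. \<bar>f x - f (flip {i} x)\<bar>)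
      = cube_mean n (\<lambda>x. f x * spin x i) - cube_mean n (\<lambda>x. f (flip {i} x) * spin x i)"
    unfolding cube_mean_diff[symmetric]
    by (rule cube_mean_cong) (simp only: monotone_fun_flip[OF assms(1) _ assms(2)] right_diff_distrib mult.commute)
  also have "cube_mean n (\<lambda>x. f (flip {i} x) * spin x i) = - cube_mean n (\<lambda>x. f x * spin x i)"
    using cube_mean_flip[of "{i}" n "\<lambda>x. f x * spin (flip {i} x) i"] assms(2)
    by (simp add: spin_flip cube_mean_uminus)
  finally show ?thesis by (simp add: fourier_def)
qed

lemma monotone_fun_fourier_nonneg:
  assumes "monotone_fun n f" "i < n"
  shows "0 \<le> fourier n f {i}"
proof -
  have "0 \<le> cube_mean n (\<lambda>x. \<bar>f x - f (flip {i} x)\<bar>)"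
    by (rule cube_mean_nonneg) simp
  then show ?thesis
    by (simp add: monotone_fun_influence[OF assms])
qed

text \<open>A majority is unchanged when all weights are multiplied by a positive constant, so
  nonnegative weights can be scaled into \<open>{0..1}\<close>.\<close>

lemma Lambda_tilde_ge:
  assumes "\<And>j. j < n \<Longrightarrow> 0 \<le> w j"
  shows "\<bar>cube_mean n (\<lambda>x. indicator A x * weighted_majority n w x)\<bar> \<le> Lambda_tilde n A"
proof -
  \<comment> \<open>The summand 1 keeps \<open>c\<close> positive when all weights vanish.\<close>
  define c where "c = 1 + (\<Sum>j<n. w j)"
  define v where "v = (\<lambda>j\<in>{..<n}. w j / c)"
  have "0 \<le> (\<Sum>j<n. w j)" using assms by (intro sum_nonneg) simp
  then have c: "c > 0" by (simp add: c_def)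
  have "w j \<le> c" if "j < n" for j
  proof -
    have "w j \<le> (\<Sum>j<n. w j)" using assms that by (intro member_le_sum) auto
    then show ?thesis by (simp add: c_def)
  qed
  then have "v \<in> (\<Pi>\<^sub>E j\<in>{..<n}. {0..1})"
    using c assms by (auto simp: v_def)
  moreover have "weighted_majority n v x = weighted_majority n w x" for x
  proof -
    have "(\<Sum>j<n. spin x j * v j) = (\<Sum>j<n. spin x j * w j) / c"
      by (simp add: v_def sum_divide_distrib)
    then show ?thesis
      using c by (simp add: weighted_majority_spin sgn_divide)
  qed
  then have "majority_correlation n A v
      = \<bar>cube_mean n (\<lambda>x. indicator A x * weighted_majority n w x)\<bar>"
    by (simp add: majority_correlation_def expectation_unif)
  ultimately show ?thesis
    unfolding Lambda_tilde_def by (intro Max_ge finite_majority_correlation) (metis imageI)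
qed

lemma Lambda_tilde_le:
  assumes "\<And>w. \<bar>cube_mean n (\<lambda>x. indicator A x * weighted_majority n w x)\<bar> \<le> c"
  shows "Lambda_tilde n A \<le> c"
proof -
  have "(\<Pi>\<^sub>E j\<in>{..<n}. {0..1 :: real}) \<noteq> {}"
    by (auto simp: PiE_eq_empty_iff)
  then show ?thesis
    unfolding Lambda_tilde_def
    by (intro Max.boundedI finite_majority_correlation)
       (auto simp: majority_correlation_def expectation_unif intro: assms)
qed

text \<open>Putting all weight on \<open>i\<close> turns the majority into the dictator
  \<open>spin x i\<close>.\<close>

lemma fourier_singleton_le_majority:
  assumes "i < n"
    and "\<And>w. (\<And>j. j < n \<Longrightarrow> 0 \<le> w j) \<Longrightarrow> \<bar>cube_mean n (\<lambda>x. f x * weighted_majority n w x)\<bar> \<le> \<Lambda>"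
  shows "fourier n f {i} \<le> \<Lambda>"
proof -
  have "weighted_majority n (\<lambda>j. of_bool (j = i)) x = spin x i" for x
  proof -
    have "(\<Sum>j<n. spin x j * of_bool (j = i)) = (\<Sum>j<n. if j = i then spin x j else 0)"
      by (intro sum.cong) auto
    then show ?thesis using assms(1) by (simp add: weighted_majority_spin spin_def)
  qed
  with assms(2)[of "\<lambda>j. of_bool (j = i)"] show ?thesis
    by (simp add: fourier_def)
qed

section \<open>Signs integrated to a truncation\<close>

lemma has_vector_derivative_abs_add:
  assumes "c + t \<noteq> (0 :: real)"
  shows "((\<lambda>t. \<bar>c + t\<bar>) has_vector_derivative sgn (c + t)) (at t)"
proof -
  have lin: "((\<lambda>y. s * (c + y)) has_vector_derivative s) (at t)" for s :: real
    by (auto intro!: derivative_eq_intros)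
  show ?thesis
  proof (cases "c + t > 0")
    case True
    have "((\<lambda>y. \<bar>c + y\<bar>) has_vector_derivative 1) (at t)"
      by (rule has_vector_derivative_transform_within_open[OF lin, of "{- c<..}"]) (use True in auto)
    with True show ?thesis by simp
  next
    case False
    with assms have neg: "c + t < 0" by simp
    have "((\<lambda>y. \<bar>c + y\<bar>) has_vector_derivative - 1) (at t)"
      by (rule has_vector_derivative_transform_within_open[OF lin, of "{..<- c}"]) (use neg in auto)
    with neg show ?thesis by simp
  qed
qed

lemma has_vector_derivative_abs_diff:
  assumes "c - t \<noteq> (0 :: real)"
  shows "((\<lambda>t. \<bar>c - t\<bar>) has_vector_derivative - sgn (c - t)) (at t)"
proof -
  have "\<bar>c - t\<bar> = \<bar>- c + t\<bar>" "- sgn (c - t) = sgn (- c + t)" for t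
    by (auto simp: sgn_if)
  with has_vector_derivative_abs_add[of "- c" t] assms show ?thesis
    by simp
qed

text \<open>The difference of absolute values is twice the truncation of \<open>L\<close> to
  \<open>[-1, 1]\<close>. The error \<open>2 * (\<bar>L\<bar> - 1)\<close> beyond that interval is
  at most \<open>L\<^sup>2 / 2\<close> because \<open>(\<bar>L\<bar> - 2)\<^sup>2\<close> is
  nonnegative.\<close>

lemma abs_clip_le:
  fixes L :: real
  shows "\<bar>2 * L - (\<bar>L + 1\<bar> - \<bar>L - 1\<bar>)\<bar> \<le> L\<^sup>2 / 2"
proof -
  have "0 \<le> (\<bar>L\<bar> - 2)\<^sup>2" by simp
  then have "2 * (\<bar>L\<bar> - 1) \<le> L\<^sup>2 / 2"
    by (simp add: power2_diff)
  moreover have "\<bar>2 * L - (\<bar>L + 1\<bar> - \<bar>L - 1\<bar>)\<bar> \<le> max 0 (2 * (\<bar>L\<bar> - 1))"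
    by (auto simp: abs_if max_def)
  moreover have "0 \<le> L\<^sup>2 / 2" by simp
  ultimately show ?thesis by linarith
qed

text \<open>The coefficients \<open>a j = fourier n f {j}\<close> serve as the weights of all coordinates but the
  first one, whose weight \<open>t\<close> ranges over \<open>[0, 1]\<close>. As \<open>f\<close> hardly depends on the
  first coordinate, that coordinate acts as a random threshold \<open>t\<close> or \<open>- t\<close> for
  \<open>L = (\<Sum>j\<noteq>0. a j * spin x j)\<close>, and the integral over \<open>t\<close> of the sign of \<open>L - t\<close>
  turns the majorities into a clipped version of \<open>L\<close> itself.\<close>

lemma sum_fourier_singleton_le:
  assumes mono: "monotone_fun n f" and f: "\<And>x. x \<in> cube n \<Longrightarrow> 0 \<le> f x \<and> f x \<le> 1"
    and \<Lambda>: "\<And>w. (\<And>j. j < n \<Longrightarrow> 0 \<le> w j) \<Longrightarrow> \<bar>cube_mean n (\<lambda>x. f x * weighted_majority n w x)\<bar> \<le> \<Lambda>"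
  shows "(\<Sum>j<n. (fourier n f {j})\<^sup>2) \<le> 8 / 3 * \<Lambda> + \<Lambda>\<^sup>2"
proof (cases "n = 0")
  case True
  have "0 \<le> \<Lambda>" using \<Lambda>[of "\<lambda>_. 0"] True by auto
  with True show ?thesis by simp
next
  case False
  then have n: "0 < n" by simp
  define a where "a j = fourier n f {j}" for j
  define L where "L x = (\<Sum>j\<in>{..<n} - {0}. spin x j * a j)" for x
  define w where "w t = a(0 := t)" for t
  let ?M = "\<lambda>t. weighted_majority n (w t)"
  have a0: "0 \<le> a j" if "j < n" for j
    unfolding a_def by (rule monotone_fun_fourier_nonneg[OF mono that])
  have a0_le: "a 0 \<le> \<Lambda>"
    unfolding a_def by (rule fourier_singleton_le_majority[OF n \<Lambda>])
  have M: "?M t x = sgn (L x + spin x 0 * t)" for t x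
  proof -
    have "(\<Sum>j<n. spin x j * w t j) = (\<Sum>j\<in>{..<n} - {0}. spin x j * w t j) + (\<Sum>j\<in>{0}. spin x j * w t j)"
      using n by (intro sum.subset_diff) auto
    moreover have "(\<Sum>j\<in>{..<n} - {0}. spin x j * w t j) = L x"
      unfolding L_def by (intro sum.cong) (auto simp: w_def)
    ultimately show ?thesis by (simp add: weighted_majority_spin w_def)
  qed
  have Lflip: "L (flip {0} x) = L x" for x
    unfolding L_def by (intro sum.cong) (auto simp: spin_flip)
  define h where "h t x = sgn (L x + t) + sgn (L x - t)" for t x
  have h: "h t x = ?M t x + ?M t (flip {0} x)" for t x
    by (simp add: M h_def Lflip spin_flip) (simp add: spin_def)
  \<comment> \<open>Twice the majority correlation gives \<open>2 * \<Lambda>\<close>; moving the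
    flip from the majority to \<open>f\<close> costs the influence of coordinate 0, which is
    \<open>2 * a 0\<close> and so at most another \<open>2 * \<Lambda>\<close>.\<close>
  have small: "\<bar>cube_mean n (\<lambda>x. f x * h t x)\<bar> \<le> 4 * \<Lambda>" if "0 \<le> t" for t
  proof -
    have "cube_mean n (\<lambda>x. f x * ?M t (flip {0} x)) = cube_mean n (\<lambda>x. f (flip {0} x) * ?M t x)"
      using cube_mean_flip[of "{0}" n "\<lambda>x. f (flip {0} x) * ?M t x"] n by simp
    then have "cube_mean n (\<lambda>x. f x * h t x)
        = 2 * cube_mean n (\<lambda>x. f x * ?M t x) - cube_mean n (\<lambda>x. (f x - f (flip {0} x)) * ?M t x)"
      by (simp add: h distrib_left left_diff_distrib cube_mean_add cube_mean_diff)
    moreover have "\<bar>cube_mean n (\<lambda>x. f x * ?M t x)\<bar> \<le> \<Lambda>"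
      using that a0 by (intro \<Lambda>) (simp add: w_def)
    moreover have "\<bar>cube_mean n (\<lambda>x. (f x - f (flip {0} x)) * ?M t x)\<bar> \<le> 2 * a 0"
    proof -
      have "\<bar>cube_mean n (\<lambda>x. (f x - f (flip {0} x)) * ?M t x)\<bar>
          \<le> cube_mean n (\<lambda>x. \<bar>(f x - f (flip {0} x)) * ?M t x\<bar>)"
        by (rule abs_cube_mean_le)
      also have "\<dots> \<le> cube_mean n (\<lambda>x. \<bar>f x - f (flip {0} x)\<bar>)"
        by (intro cube_mean_mono) (simp add: abs_mult abs_weighted_majority_le mult_left_le)
      also have "\<dots> = 2 * a 0"
        unfolding a_def by (rule monotone_fun_influence[OF mono n])
      finally show ?thesis .
    qed
    ultimately show ?thesis using a0_le by linarith
  qed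
  define G where "G t = cube_mean n (\<lambda>x. f x * (\<bar>L x + t\<bar> - \<bar>L x - t\<bar>))" for t
  have "((\<lambda>t. cube_mean n (\<lambda>x. f x * h t x)) has_integral (G 1 - G 0)) {0..1}"
  \<comment> \<open>\<open>G\<close> is an antiderivative away from its possible kinks at the values
    \<open>L x\<close> and \<open>- L x\<close>, a finite set.\<close>
  proof (rule fundamental_theorem_of_calculus_strong[of "L ` cube n \<union> (\<lambda>x. - L x) ` cube n"])
    fix t assume t: "t \<in> {0..1} - (L ` cube n \<union> (\<lambda>x. - L x) ` cube n)"
    have "((\<lambda>t. \<bar>L x + t\<bar> - \<bar>L x - t\<bar>) has_vector_derivative h t x) (at t)" if "x \<in> cube n" for x
    proof -
      have "L x + t \<noteq> 0" "L x - t \<noteq> 0" using t that by (force simp: add_eq_0_iff)+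
      from has_vector_derivative_diff[OF has_vector_derivative_abs_add[OF this(1)]
          has_vector_derivative_abs_diff[OF this(2)]]
      show ?thesis by (simp add: h_def)
    qed
    then show "(G has_vector_derivative cube_mean n (\<lambda>x. f x * h t x)) (at t)"
      unfolding G_def cube_mean_def
      by (intro has_vector_derivative_divide has_vector_derivative_sum has_vector_derivative_mult_right)
  next
    show "continuous_on {0..1} G"
      unfolding G_def cube_mean_def by (intro continuous_intros) auto
  qed (simp_all add: finite_cube)
  then have "norm (G 1 - G 0) \<le> 4 * \<Lambda> * measure lborel (cbox 0 (1 :: real))"
    using small order_trans[OF abs_ge_zero small[of 0]] by (intro has_integral_bound[where f = "\<lambda>t. cube_mean n (\<lambda>x. f x * h t x)"]) auto
  then have G1: "G 1 \<le> 4 * \<Lambda>"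
    by (simp add: G_def)
  define V where "V = (\<Sum>j\<in>{..<n} - {0}. (a j)\<^sup>2)"
  have fL: "cube_mean n (\<lambda>x. f x * L x) = V"
    by (simp add: L_def V_def sum_distrib_left cube_mean_sum a_def fourier_def power2_eq_square
        cube_mean_multc[symmetric] mult.assoc)
  have LL: "cube_mean n (\<lambda>x. (L x)\<^sup>2) = V"
  proof -
    have "cube_mean n (\<lambda>x. (L x)\<^sup>2)
        = (\<Sum>i\<in>{..<n} - {0}. \<Sum>j\<in>{..<n} - {0}. cube_mean n (\<lambda>x. spin x i * a i * (spin x j * a j)))"
      by (simp add: L_def power2_eq_square sum_product cube_mean_sum)
    also have "\<dots> = (\<Sum>i\<in>{..<n} - {0}. \<Sum>j\<in>{..<n} - {0}. if i = j then a i * a j else 0)"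
    proof (intro sum.cong refl)
      fix i j assume "i \<in> {..<n} - {0}" "j \<in> {..<n} - {0}"
      then have "cube_mean n (\<lambda>x. spin x i * spin x j) = of_bool (i = j)"
        using walsh_orthonormal[of "{i}" n "{j}"] by simp
      then show "cube_mean n (\<lambda>x. spin x i * a i * (spin x j * a j)) = (if i = j then a i * a j else 0)"
        using cube_mean_multc[of n "\<lambda>x. spin x i * spin x j" "a i * a j"]
        by (simp add: mult_ac)
    qed
    also have "\<dots> = V"
      by (simp add: V_def power2_eq_square)
    finally show ?thesis .
  qed
  have "2 * V - G 1 = cube_mean n (\<lambda>x. f x * (2 * L x - (\<bar>L x + 1\<bar> - \<bar>L x - 1\<bar>)))"
    unfolding G_def fL[symmetric] cube_mean_cmult[symmetric] cube_mean_diff[symmetric]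
    by (simp add: algebra_simps)
  also have "\<dots> \<le> cube_mean n (\<lambda>x. (L x)\<^sup>2 * (1 / 2))"
  proof (rule cube_mean_mono)
    fix x assume x: "x \<in> cube n"
    have "f x * (2 * L x - (\<bar>L x + 1\<bar> - \<bar>L x - 1\<bar>)) \<le> \<bar>f x\<bar> * \<bar>2 * L x - (\<bar>L x + 1\<bar> - \<bar>L x - 1\<bar>)\<bar>"
      unfolding abs_mult[symmetric] by (rule abs_ge_self)
    also have "\<dots> \<le> 1 * ((L x)\<^sup>2 / 2)"
      using f[OF x] by (intro mult_mono abs_clip_le) auto
    finally show "f x * (2 * L x - (\<bar>L x + 1\<bar> - \<bar>L x - 1\<bar>)) \<le> (L x)\<^sup>2 * (1 / 2)" by simp
  qed
  also have "\<dots> = V / 2"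
    unfolding cube_mean_multc LL by simp
  \<comment> \<open>The chain gives \<open>2 * V - G 1 \<le> V / 2\<close> with
    \<open>G 1 \<le> 4 * \<Lambda>\<close>, hence 8/3. Coordinate 0, left out of \<open>V\<close>,
    adds the term \<open>\<Lambda>\<^sup>2\<close>.\<close>
  finally have "V \<le> 8 / 3 * \<Lambda>" using G1 by linarith
  moreover have "(\<Sum>j<n. (a j)\<^sup>2) = V + (a 0)\<^sup>2"
    unfolding V_def using n by (subst sum.subset_diff[of "{0}"]) auto
  moreover have "(a 0)\<^sup>2 \<le> \<Lambda>\<^sup>2"
    using a0_le a0[OF n] by (rule power_mono)
  ultimately show ?thesis by (simp add: a_def)
qed

section \<open>Hypercontractivity and monotone functions\<close>

lemma sum_Pow_lessThan_Suc:
  fixes n :: nat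
  shows "(\<Sum>S\<in>Pow {..<Suc n}. g S) = (\<Sum>S\<in>Pow {..<n}. g S) + (\<Sum>S\<in>Pow {..<n}. g (insert n S))"
proof -
  have "inj_on (insert n) (Pow {..<n})"
    by (rule inj_onI) (metis PowD insert_ident lessThan_iff less_irrefl subsetD)
  moreover have "Pow {..<n} \<inter> insert n ` Pow {..<n} = {}"
    by auto
  ultimately show ?thesis
    by (simp add: lessThan_Suc Pow_insert sum.union_disjoint sum.reindex)
qed

text \<open>A nonempty \<open>S\<close> is \<open>insert j T\<close> for exactly one pair with
  \<open>T\<close> below \<open>j\<close>, namely with \<open>j\<close> its maximum.\<close>

lemma sum_Pow_by_Max:
  fixes n :: nat and g :: "nat set \<Rightarrow> real"
  shows "(\<Sum>S\<in>Pow {..<n} - {{}}. g S) = (\<Sum>j<n. \<Sum>T\<in>Pow {..<j}. g (insert j T))"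
proof (induction n)
  case (Suc n)
  have "(\<Sum>S\<in>Pow {..<k} - {{}}. g S) = (\<Sum>S\<in>Pow {..<k}. g S) - g {}" for k
    by (subst sum_diff1) auto
  with Suc show ?case
    by (simp add: sum_Pow_lessThan_Suc)
qed simp

text \<open>Bonami's induction: split off the last spin as \<open>u + \<rho> * spin * v\<close>.
  Averaging over it cancels the odd powers, and \<open>6 * \<rho>\<^sup>2 = 2\<close> turns the
  middle term into \<open>2 * u\<^sup>2 * v\<^sup>2\<close>, which by Cauchy-Schwarz fits the cross
  term of \<open>(A + B)\<^sup>2\<close>.\<close>

lemma hypercontractive_2_4:
  assumes \<rho>: "\<rho>\<^sup>2 = 1 / 3"
  shows "cube_mean n (\<lambda>x. (\<Sum>S\<in>Pow {..<n}. \<rho> ^ card S * a S * walsh S x) ^ 4)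
           \<le> (\<Sum>S\<in>Pow {..<n}. (a S)\<^sup>2)\<^sup>2"
proof (induction n arbitrary: a)
  case 0
  have "(a {}) ^ 4 = ((a {})\<^sup>2)\<^sup>2" by simp
  then show ?case by (simp add: del: power_mult)
next
  case (Suc n)
  define u where "u x = (\<Sum>S\<in>Pow {..<n}. \<rho> ^ card S * a S * walsh S x)" for x
  define v where "v x = (\<Sum>S\<in>Pow {..<n}. \<rho> ^ card S * a (insert n S) * walsh S x)" for x
  define A where "A = (\<Sum>S\<in>Pow {..<n}. (a S)\<^sup>2)"
  define B where "B = (\<Sum>S\<in>Pow {..<n}. (a (insert n S))\<^sup>2)"
  have A: "cube_mean n (\<lambda>x. u x ^ 4) \<le> A\<^sup>2" and B: "cube_mean n (\<lambda>x. v x ^ 4) \<le> B\<^sup>2"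
    unfolding u_def v_def A_def B_def by (rule Suc.IH)+
  have AB: "0 \<le> A" "0 \<le> B"
    by (auto simp: A_def B_def intro: sum_nonneg)
  have decomp: "(\<Sum>S\<in>Pow {..<Suc n}. \<rho> ^ card S * a S * walsh S (x(n := b)))
      = u x + \<rho> * (2 * of_bool b - 1) * v x" for x b
  proof -
    have "walsh S (x(n := b)) = walsh S x" if "S \<subseteq> {..<n}" for S
      unfolding walsh_def spin_def using that by (intro prod.cong) auto
    moreover have "walsh (insert n S) (x(n := b)) = (2 * of_bool b - 1) * walsh S x"
      and "card (insert n S) = Suc (card S)" if "S \<subseteq> {..<n}" for S
    proof -
      have S: "finite S" "n \<notin> S" using that finite_subset by auto
      have "(\<Prod>j\<in>S. spin (x(n := b)) j) = (\<Prod>j\<in>S. spin x j)"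
        using S by (intro prod.cong) (auto simp: spin_def)
      with S show "walsh (insert n S) (x(n := b)) = (2 * of_bool b - 1) * walsh S x"
        by (simp add: walsh_def spin_def)
      show "card (insert n S) = Suc (card S)" using S by simp
    qed
    ultimately show ?thesis
      unfolding sum_Pow_lessThan_Suc u_def v_def sum_distrib_left
      by (intro arg_cong2[where f = plus] sum.cong) (auto simp: mult_ac)
  qed
  have "cube_mean (Suc n) (\<lambda>x. (\<Sum>S\<in>Pow {..<Suc n}. \<rho> ^ card S * a S * walsh S x) ^ 4)
      = cube_mean n (\<lambda>x. ((u x + \<rho> * v x) ^ 4 + (u x - \<rho> * v x) ^ 4) * (1 / 2))"
    unfolding cube_mean_Suc decomp cube_mean_multc cube_mean_add by simp
  also have "\<dots> = cube_mean n (\<lambda>x. u x ^ 4 + 2 * ((u x)\<^sup>2 * (v x)\<^sup>2) + 1 / 9 * v x ^ 4)"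
  proof (rule cube_mean_cong)
    fix x
    have "((p + q) ^ 4 + (p - q) ^ 4) * (1 / 2) = p ^ 4 + 6 * p\<^sup>2 * q\<^sup>2 + (q\<^sup>2)\<^sup>2" for p q :: real
      by (simp add: power4_eq_xxxx power2_eq_square algebra_simps)
    from this[of "u x" "\<rho> * v x"]
    show "((u x + \<rho> * v x) ^ 4 + (u x - \<rho> * v x) ^ 4) * (1 / 2)
        = u x ^ 4 + 2 * ((u x)\<^sup>2 * (v x)\<^sup>2) + 1 / 9 * v x ^ 4"
      by (simp add: power_mult_distrib \<rho> power_divide)
  qed
  also have "\<dots> = cube_mean n (\<lambda>x. u x ^ 4) + 2 * cube_mean n (\<lambda>x. (u x)\<^sup>2 * (v x)\<^sup>2)
                 + 1 / 9 * cube_mean n (\<lambda>x. v x ^ 4)"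
    by (simp only: cube_mean_add cube_mean_cmult)
  also have "\<dots> \<le> A\<^sup>2 + 2 * (A * B) + B\<^sup>2"
  proof -
    have "(cube_mean n (\<lambda>x. (u x)\<^sup>2 * (v x)\<^sup>2))\<^sup>2
        \<le> cube_mean n (\<lambda>x. ((u x)\<^sup>2)\<^sup>2) * cube_mean n (\<lambda>x. ((v x)\<^sup>2)\<^sup>2)"
      by (rule cube_mean_Cauchy_Schwarz)
    also have "\<dots> = cube_mean n (\<lambda>x. u x ^ 4) * cube_mean n (\<lambda>x. v x ^ 4)"
      by simp
    also have "\<dots> \<le> A\<^sup>2 * B\<^sup>2"
      by (intro mult_mono A B cube_mean_nonneg) auto
    finally have "(cube_mean n (\<lambda>x. (u x)\<^sup>2 * (v x)\<^sup>2))\<^sup>2 \<le> (A * B)\<^sup>2"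
      by (simp add: power_mult_distrib)
    then have "cube_mean n (\<lambda>x. (u x)\<^sup>2 * (v x)\<^sup>2) \<le> A * B"
      by (rule power2_le_imp_le) (use AB in simp)
    moreover have "0 \<le> cube_mean n (\<lambda>x. v x ^ 4)"
      by (rule cube_mean_nonneg) simp
    ultimately show ?thesis using A B by linarith
  qed
  also have "\<dots> = (A + B)\<^sup>2"
    by (simp add: power2_sum)
  finally show ?case
    by (simp add: sum_Pow_lessThan_Suc A_def B_def)
qed

text \<open>This is \<open>\<parallel>T g\<parallel>\<^sub>2 \<le> \<parallel>g\<parallel>\<^sub>p\<close> for \<open>p = 4 / 3\<close>, the dual of the bound from \<open>L\<^sup>2\<close> to \<open>L\<^sup>4\<close>,
  with \<open>\<parallel>g\<parallel>\<^sub>p\<close> interpolated between \<open>\<parallel>g\<parallel>\<^sub>1\<close> and \<open>\<parallel>g\<parallel>\<^sub>2\<close>.\<close>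

lemma noise_stability_le_L1_L2:
  "(\<Sum>S\<in>Pow {..<n}. (1 / 3) ^ card S * (fourier n g S)\<^sup>2)
     \<le> cube_mean n (\<lambda>x. \<bar>g x\<bar>) * sqrt (cube_mean n (\<lambda>x. (g x)\<^sup>2))"
proof -
  define \<rho> :: real where "\<rho> = sqrt (1 / 3)"
  have \<rho>: "\<rho>\<^sup>2 = 1 / 3" by (simp add: \<rho>_def)
  have \<rho>_power: "\<rho> ^ k * \<rho> ^ k = (1 / 3) ^ k" for k
    by (metis \<rho> power2_eq_square power_mult_distrib)
  define Q where "Q = (\<Sum>S\<in>Pow {..<n}. (1 / 3) ^ card S * (fourier n g S)\<^sup>2)"
  define h where "h = noise_op n (1 / 3) g"
  have Q0: "0 \<le> Q" unfolding Q_def by (intro sum_nonneg) auto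
  have gh: "cube_mean n (\<lambda>x. g x * h x) = Q"
    unfolding Plancherel Q_def h_def
    by (intro sum.cong refl) (simp add: fourier_noise_op power2_eq_square)
  have h4: "cube_mean n (\<lambda>x. h x ^ 4) \<le> Q\<^sup>2"
  proof -
    \<comment> \<open>The multiplier 1/3 is \<open>\<rho>\<close> applied twice: one factor goes
      into the coefficients, whose square sum is then \<open>Q\<close>, the other is used by
      hypercontractivity.\<close>
    have "h x = (\<Sum>S\<in>Pow {..<n}. \<rho> ^ card S * (\<rho> ^ card S * fourier n g S) * walsh S x)" for x
      by (simp add: h_def noise_op_def \<rho>_power mult.assoc[symmetric])
    moreover have "(\<Sum>S\<in>Pow {..<n}. (\<rho> ^ card S * fourier n g S)\<^sup>2) = Q"
      unfolding Q_def by (intro sum.cong refl) (simp add: power_mult_distrib power2_eq_square \<rho>_power)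
    ultimately show ?thesis
      using hypercontractive_2_4[OF \<rho>, of n "\<lambda>S. \<rho> ^ card S * fourier n g S"] by simp
  qed
  let ?m1 = "cube_mean n (\<lambda>x. \<bar>g x\<bar>)" and ?m2 = "cube_mean n (\<lambda>x. (g x)\<^sup>2)"
  have m1: "0 \<le> ?m1" and m2: "0 \<le> ?m2" by (auto intro: cube_mean_nonneg)
  have "cube_mean n (\<lambda>x. \<bar>g x\<bar> * (h x)\<^sup>2) \<le> sqrt ?m2 * Q"
  proof (rule power2_le_imp_le)
    have "(cube_mean n (\<lambda>x. \<bar>g x\<bar> * (h x)\<^sup>2))\<^sup>2
        \<le> cube_mean n (\<lambda>x. \<bar>g x\<bar>\<^sup>2) * cube_mean n (\<lambda>x. ((h x)\<^sup>2)\<^sup>2)"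
      by (rule cube_mean_Cauchy_Schwarz)
    also have "\<dots> = ?m2 * cube_mean n (\<lambda>x. h x ^ 4)" by simp
    also have "\<dots> \<le> ?m2 * Q\<^sup>2" by (intro mult_left_mono h4 m2)
    also have "\<dots> = (sqrt ?m2 * Q)\<^sup>2" using m2 by (simp add: power_mult_distrib)
    finally show "(cube_mean n (\<lambda>x. \<bar>g x\<bar> * (h x)\<^sup>2))\<^sup>2 \<le> (sqrt ?m2 * Q)\<^sup>2" .
  qed (use m2 Q0 in simp)
  moreover have "Q\<^sup>2 \<le> ?m1 * cube_mean n (\<lambda>x. \<bar>g x\<bar> * (h x)\<^sup>2)"
  proof -
    \<comment> \<open>Splitting \<open>\<bar>g x\<bar>\<close> evenly between the two factors makes
      Cauchy-Schwarz produce the first norm of \<open>g\<close>.\<close>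
    have "g x * h x = sqrt \<bar>g x\<bar> * (sgn (g x) * sqrt \<bar>g x\<bar> * h x)" for x
      by (simp add: sgn_if)
    then have "Q\<^sup>2 = (cube_mean n (\<lambda>x. sqrt \<bar>g x\<bar> * (sgn (g x) * sqrt \<bar>g x\<bar> * h x)))\<^sup>2"
      by (simp only: gh[symmetric])
    also have "\<dots> \<le> cube_mean n (\<lambda>x. (sqrt \<bar>g x\<bar>)\<^sup>2) * cube_mean n (\<lambda>x. (sgn (g x) * sqrt \<bar>g x\<bar> * h x)\<^sup>2)"
      by (rule cube_mean_Cauchy_Schwarz)
    also have "(\<lambda>x. (sgn (g x) * sqrt \<bar>g x\<bar> * h x)\<^sup>2) = (\<lambda>x. \<bar>g x\<bar> * (h x)\<^sup>2)"
      by (auto simp: power_mult_distrib sgn_if)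
    finally show ?thesis by simp
  qed
  ultimately have "Q\<^sup>2 \<le> ?m1 * (sqrt ?m2 * Q)"
    by (elim order_trans) (rule mult_left_mono[OF _ m1])
  then have "Q * Q \<le> Q * (?m1 * sqrt ?m2)"
    by (simp add: power2_eq_square mult_ac)
  then have "Q \<le> ?m1 * sqrt ?m2"
    using Q0 m1 m2 by (cases "Q = 0") auto
  then show ?thesis by (simp only: Q_def)
qed

section \<open>Revealing the coordinates in order\<close>

definition mix :: "nat \<Rightarrow> (nat \<Rightarrow> bool) \<Rightarrow> (nat \<Rightarrow> bool) \<Rightarrow> nat \<Rightarrow> bool" where
  "mix j x y = (\<lambda>i. if i < j then x i else y i)"

text \<open>The expectation of \<open>f y * spin y j\<close> conditional on the first \<open>j\<close> coordinates of \<open>y\<close>.\<close>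

definition past_coefficient :: "nat \<Rightarrow> ((nat \<Rightarrow> bool) \<Rightarrow> real) \<Rightarrow> nat \<Rightarrow> (nat \<Rightarrow> bool) \<Rightarrow> real" where
  "past_coefficient n f j x = cube_mean n (\<lambda>y. f (mix j x y) * spin y j)"

lemma mix_in_cube: "x \<in> cube n \<Longrightarrow> y \<in> cube n \<Longrightarrow> mix j x y \<in> cube n"
  by (auto simp: cube_def mix_def PiE_iff extensional_def)

lemma walsh_mix:
  assumes "finite S"
  shows "walsh S (mix j x y) = walsh (S \<inter> {..<j}) x * walsh (S - {..<j}) y"
proof -
  have "walsh S (mix j x y) = (\<Prod>i\<in>S \<inter> {..<j}. spin (mix j x y) i) * (\<Prod>i\<in>S - {..<j}. spin (mix j x y) i)"
    unfolding walsh_def by (subst prod.union_disjoint[symmetric]) (use assms in \<open>auto simp: Int_Diff_Un\<close>)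
  then show ?thesis
    by (simp add: walsh_def spin_def mix_def)
qed

text \<open>Averaging over the coordinates from \<open>j\<close> on, against
  \<open>spin y j\<close>, keeps just the Walsh functions whose part in those coordinates is
  \<open>{j}\<close>.\<close>

lemma fourier_past_coefficient:
  assumes "j < n" "T \<subseteq> {..<n}"
  shows "fourier n (past_coefficient n f j) T = (if T \<subseteq> {..<j} then fourier n f (insert j T) else 0)"
proof -
  let ?a = "\<lambda>T. if T \<subseteq> {..<j} then fourier n f (insert j T) else 0"
  have "past_coefficient n f j x = (\<Sum>T\<in>Pow {..<n}. ?a T * walsh T x)" if x: "x \<in> cube n" for x
  proof -
    have "past_coefficient n f j x
        = cube_mean n (\<lambda>y. \<Sum>S\<in>Pow {..<n}. fourier n f S * (walsh (S \<inter> {..<j}) x * (walsh (S - {..<j}) y * walsh {j} y)))"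
      unfolding past_coefficient_def
    proof (rule cube_mean_cong)
      fix y assume y: "y \<in> cube n"
      have "f (mix j x y) = (\<Sum>S\<in>Pow {..<n}. fourier n f S * (walsh (S \<inter> {..<j}) x * walsh (S - {..<j}) y))"
        unfolding walsh_expansion[OF mix_in_cube[OF x y], of f]
        by (intro sum.cong refl) (simp add: walsh_mix finite_subset[of _ "{..<n}"])
      then show "f (mix j x y) * spin y j
          = (\<Sum>S\<in>Pow {..<n}. fourier n f S * (walsh (S \<inter> {..<j}) x * (walsh (S - {..<j}) y * walsh {j} y)))"
        by (simp add: sum_distrib_right mult.assoc)
    qed
    also have "\<dots> = (\<Sum>S\<in>Pow {..<n}. fourier n f S * (walsh (S \<inter> {..<j}) x * of_bool (S - {..<j} = {j})))"
      unfolding cube_mean_sum cube_mean_cmult using assms(1)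
      by (intro sum.cong refl) (subst walsh_orthonormal; auto)
    also have "\<dots> = (\<Sum>S\<in>{S \<in> Pow {..<n}. S - {..<j} = {j}}. fourier n f S * walsh (S \<inter> {..<j}) x)"
      by (intro sum.mono_neutral_cong_right) auto
    also have "\<dots> = (\<Sum>T\<in>Pow {..<j}. fourier n f (insert j T) * walsh T x)"
    proof (rule sum.reindex_bij_witness[of _ "insert j" "\<lambda>S. S \<inter> {..<j}"])
      fix S assume "S \<in> {S \<in> Pow {..<n}. S - {..<j} = {j}}"
      then have "S - {..<j} = {j}" by blast
      then show "insert j (S \<inter> {..<j}) = S" by blast
      then show "fourier n f (insert j (S \<inter> {..<j})) * walsh (S \<inter> {..<j}) x = fourier n f S * walsh (S \<inter> {..<j}) x"
        by simp
    qed (use assms(1) in auto)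
    also have "\<dots> = (\<Sum>T\<in>Pow {..<n}. ?a T * walsh T x)"
      using assms(1) by (intro sum.mono_neutral_cong_left) (auto simp: subset_eq)
    finally show ?thesis .
  qed
  then have "fourier n (past_coefficient n f j) T = fourier n (\<lambda>x. \<Sum>T\<in>Pow {..<n}. ?a T * walsh T x) T"
    unfolding fourier_def by (intro cube_mean_cong) simp
  then show ?thesis
    by (simp only: fourier_walsh_sum[OF assms(2)])
qed

text \<open>Pairing \<open>y\<close> with \<open>flip {j} y\<close> turns the integrand into the
  absolute change of \<open>f\<close> across coordinate \<open>j\<close>.\<close>

lemma past_coefficient_nonneg:
  assumes "monotone_fun n f" "x \<in> cube n" "j < n"
  shows "0 \<le> past_coefficient n f j x"
proof -
  let ?p = "\<lambda>y. f (mix j x y) * spin y j"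
  have "0 \<le> cube_mean n (\<lambda>y. ?p y + ?p (flip {j} y))"
  proof (rule cube_mean_nonneg)
    fix y assume y: "y \<in> cube n"
    have "mix j x (flip {j} y) = flip {j} (mix j x y)" and "spin (mix j x y) j = spin y j"
      by (auto simp: mix_def flip_def spin_def)
    then have "?p y + ?p (flip {j} y)
        = spin (mix j x y) j * (f (mix j x y) - f (flip {j} (mix j x y)))"
      by (simp add: spin_flip algebra_simps)
    also have "\<dots> = \<bar>f (mix j x y) - f (flip {j} (mix j x y))\<bar>"
      by (rule monotone_fun_flip[OF assms(1) mix_in_cube[OF assms(2) y] assms(3), symmetric])
    finally show "0 \<le> ?p y + ?p (flip {j} y)" by simp
  qed
  then show ?thesis
    using cube_mean_flip[of "{j}" n ?p] assms(3)
    by (simp add: cube_mean_add past_coefficient_def)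
qed

text \<open>The terms are grouped by the largest element \<open>j\<close> of \<open>S\<close>. Those with a given \<open>j\<close> make up the
  noise stability of a past coefficient, whose \<open>L\<^sup>1\<close> norm is only \<open>fourier n f {j}\<close>
  because it is nonnegative.\<close>

lemma monotone_fun_noise_stability_le:
  assumes mono: "monotone_fun n f"
  shows "(\<Sum>S\<in>Pow {..<n} - {{}}. (1 / 3) ^ card S * (fourier n f S)\<^sup>2)
    \<le> sqrt (\<Sum>j<n. (fourier n f {j})\<^sup>2) * sqrt (cube_mean n (\<lambda>x. (f x)\<^sup>2))"
proof -
  let ?g = "past_coefficient n f"
  have restrict: "(\<Sum>T\<in>Pow {..<j}. c T * (fourier n f (insert j T))\<^sup>2)
      = (\<Sum>T\<in>Pow {..<n}. c T * (fourier n (?g j) T)\<^sup>2)" if "j < n" for j and c :: "nat set \<Rightarrow> real"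
  proof (rule sum.mono_neutral_cong_left)
    show "Pow {..<j} \<subseteq> Pow {..<n}" using that by auto
    then show "c T * (fourier n f (insert j T))\<^sup>2 = c T * (fourier n (?g j) T)\<^sup>2"
      if "T \<in> Pow {..<j}" for T
      using that \<open>j < n\<close> by (simp add: fourier_past_coefficient subset_iff)
  qed (use that in \<open>auto simp: fourier_past_coefficient\<close>)
  have L2: "(\<Sum>T\<in>Pow {..<j}. (fourier n f (insert j T))\<^sup>2) = cube_mean n (\<lambda>x. (?g j x)\<^sup>2)"
    if "j < n" for j
    using restrict[OF that, of "\<lambda>_. 1"] by (simp add: Parseval)
  have L1: "cube_mean n (\<lambda>x. \<bar>?g j x\<bar>) = fourier n f {j}" if "j < n" for j
  proof -
    have "cube_mean n (\<lambda>x. \<bar>?g j x\<bar>) = fourier n (?g j) {}"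
      unfolding fourier_def using past_coefficient_nonneg[OF mono _ that]
      by (intro cube_mean_cong) simp
    then show ?thesis using that by (simp add: fourier_past_coefficient)
  qed
  have level: "(\<Sum>T\<in>Pow {..<j}. (1 / 3) ^ card (insert j T) * (fourier n f (insert j T))\<^sup>2)
      \<le> fourier n f {j} * sqrt (cube_mean n (\<lambda>x. (?g j x)\<^sup>2))" if "j < n" for j
  proof -
    \<comment> \<open>The factor 1/3 due to \<open>j\<close> is given away, so that the exponents
      fit the coefficients of \<open>?g j\<close>.\<close>
    have "(\<Sum>T\<in>Pow {..<j}. (1 / 3) ^ card (insert j T) * (fourier n f (insert j T))\<^sup>2)
        \<le> (\<Sum>T\<in>Pow {..<j}. (1 / 3) ^ card T * (fourier n f (insert j T))\<^sup>2)"
      by (intro sum_mono mult_right_mono power_decreasing card_mono)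
         (auto intro: finite_subset[of _ "{..<j}"])
    also have "\<dots> = (\<Sum>T\<in>Pow {..<n}. (1 / 3) ^ card T * (fourier n (?g j) T)\<^sup>2)"
      by (rule restrict[OF that])
    also have "\<dots> \<le> cube_mean n (\<lambda>x. \<bar>?g j x\<bar>) * sqrt (cube_mean n (\<lambda>x. (?g j x)\<^sup>2))"
      by (rule noise_stability_le_L1_L2)
    finally show ?thesis by (simp only: L1[OF that])
  qed
  have "(\<Sum>S\<in>Pow {..<n} - {{}}. (1 / 3) ^ card S * (fourier n f S)\<^sup>2)
      \<le> (\<Sum>j<n. fourier n f {j} * sqrt (cube_mean n (\<lambda>x. (?g j x)\<^sup>2)))"
    unfolding sum_Pow_by_Max by (intro sum_mono level) simp
  also have "\<dots> \<le> sqrt ((\<Sum>j<n. (fourier n f {j})\<^sup>2) * (\<Sum>j<n. (sqrt (cube_mean n (\<lambda>x. (?g j x)\<^sup>2)))\<^sup>2))"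
    by (intro real_le_rsqrt Cauchy_Schwarz_ineq_sum)
  \<comment> \<open>The squared norms of the past coefficients split the Fourier weight of
    \<open>f\<close> on nonempty sets according to the maximum.\<close>
  also have "(\<Sum>j<n. (sqrt (cube_mean n (\<lambda>x. (?g j x)\<^sup>2)))\<^sup>2) = (\<Sum>S\<in>Pow {..<n} - {{}}. (fourier n f S)\<^sup>2)"
    unfolding sum_Pow_by_Max
    by (intro sum.cong refl) (simp add: L2 real_sqrt_pow2 cube_mean_nonneg)
  also have "sqrt ((\<Sum>j<n. (fourier n f {j})\<^sup>2) * \<dots>)
      \<le> sqrt ((\<Sum>j<n. (fourier n f {j})\<^sup>2) * cube_mean n (\<lambda>x. (f x)\<^sup>2))"
    unfolding Parseval by (intro real_sqrt_le_mono mult_left_mono sum_mono2 sum_nonneg) auto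
  finally show ?thesis by (simp add: real_sqrt_mult)
qed

section \<open>Sensitivity gauge\<close>

text \<open>Parseval; subtracting the mean removes exactly the coefficient at
  \<open>{}\<close>.\<close>

lemma cube_mean_noise_op_deviation:
  "cube_mean n (\<lambda>x. (noise_op n \<theta> f x - cube_mean n f)\<^sup>2)
     = (\<Sum>S\<in>Pow {..<n} - {{}}. (\<theta> ^ card S * fourier n f S)\<^sup>2)"
proof -
  let ?d = "\<lambda>x. noise_op n \<theta> f x - cube_mean n f"
  have d: "fourier n ?d S = \<theta> ^ card S * fourier n f S - cube_mean n f * of_bool (S = {})"
    if "S \<subseteq> {..<n}" for S
  proof -
    have "cube_mean n (walsh S) = of_bool (S = {})"
      using walsh_orthonormal[OF that, of "{}"] by simp
    then have "fourier n ?d S = fourier n (noise_op n \<theta> f) S - cube_mean n f * of_bool (S = {})"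
      by (simp add: fourier_def left_diff_distrib cube_mean_diff cube_mean_cmult)
    then show ?thesis by (simp only: fourier_noise_op[OF that])
  qed
  have "fourier n f {} = cube_mean n f" by (simp add: fourier_def)
  then show ?thesis
    unfolding Parseval
    by (intro sum.mono_neutral_cong_right) (auto simp: d)
qed

text \<open>A cut at level \<open>k\<close>: up to it the multiplier is at most
  \<open>1 \<le> 3 ^ k * (1 / 3) ^ card S\<close>, above it the squared multiplier is at most
  \<open>\<theta> ^ k\<close>.\<close>

lemma noise_op_deviation_le:
  assumes mono: "monotone_fun n f" and f: "\<And>x. x \<in> cube n \<Longrightarrow> 0 \<le> f x \<and> f x \<le> 1"
    and \<theta>: "0 \<le> \<theta>" "\<theta> \<le> 1"
  shows "cube_mean n (\<lambda>x. (noise_op n \<theta> f x - cube_mean n f)\<^sup>2)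
    \<le> 3 ^ k * sqrt (\<Sum>j<n. (fourier n f {j})\<^sup>2) + \<theta> ^ k"
proof -
  have "cube_mean n (\<lambda>x. (f x)\<^sup>2) \<le> cube_mean n (\<lambda>x. 1)"
    using f by (intro cube_mean_mono) (simp add: abs_square_le_1)
  then have f2: "cube_mean n (\<lambda>x. (f x)\<^sup>2) \<le> 1" by simp
  have "(\<theta> ^ card S * fourier n f S)\<^sup>2
      \<le> 3 ^ k * ((1 / 3) ^ card S * (fourier n f S)\<^sup>2) + \<theta> ^ k * (fourier n f S)\<^sup>2" for S
  proof -
    have "(\<theta> ^ card S)\<^sup>2 \<le> 3 ^ k * (1 / 3) ^ card S + \<theta> ^ k"
    proof (cases "card S \<le> k")
      case True
      then have "(3 :: real) ^ card S \<le> 3 ^ k" by (intro power_increasing) auto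
      then have "1 \<le> 3 ^ k * (1 / 3 :: real) ^ card S" by (simp add: power_divide)
      moreover have "(\<theta> ^ card S)\<^sup>2 \<le> 1"
        using \<theta> by (simp add: abs_square_le_1 power_le_one)
      moreover have "0 \<le> \<theta> ^ k" using \<theta> by simp
      ultimately show ?thesis by linarith
    next
      case False
      then have "(\<theta> ^ card S)\<^sup>2 \<le> \<theta> ^ k"
        unfolding power_mult[symmetric] using \<theta> by (intro power_decreasing) auto
      then show ?thesis by (simp add: add_increasing)
    qed
    from mult_right_mono[OF this, of "(fourier n f S)\<^sup>2"] show ?thesis
      by (simp add: power_mult_distrib algebra_simps)
  qed
  then have "cube_mean n (\<lambda>x. (noise_op n \<theta> f x - cube_mean n f)\<^sup>2)
      \<le> 3 ^ k * (\<Sum>S\<in>Pow {..<n} - {{}}. (1 / 3) ^ card S * (fourier n f S)\<^sup>2)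
        + \<theta> ^ k * (\<Sum>S\<in>Pow {..<n} - {{}}. (fourier n f S)\<^sup>2)"
    unfolding cube_mean_noise_op_deviation sum_distrib_left sum.distrib[symmetric]
    by (intro sum_mono)
  also have "\<dots> \<le> 3 ^ k * (sqrt (\<Sum>j<n. (fourier n f {j})\<^sup>2) * 1) + \<theta> ^ k * 1"
  proof (intro add_mono mult_left_mono)
    have "(\<Sum>S\<in>Pow {..<n} - {{}}. (1 / 3) ^ card S * (fourier n f S)\<^sup>2)
        \<le> sqrt (\<Sum>j<n. (fourier n f {j})\<^sup>2) * sqrt (cube_mean n (\<lambda>x. (f x)\<^sup>2))"
      by (rule monotone_fun_noise_stability_le[OF mono])
    also have "\<dots> \<le> sqrt (\<Sum>j<n. (fourier n f {j})\<^sup>2) * 1"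
      using f2 by (intro mult_left_mono) (auto intro: sum_nonneg)
    finally show "(\<Sum>S\<in>Pow {..<n} - {{}}. (1 / 3) ^ card S * (fourier n f S)\<^sup>2)
        \<le> sqrt (\<Sum>j<n. (fourier n f {j})\<^sup>2) * 1" .
    have "(\<Sum>S\<in>Pow {..<n} - {{}}. (fourier n f S)\<^sup>2) \<le> cube_mean n (\<lambda>x. (f x)\<^sup>2)"
      unfolding Parseval by (intro sum_mono2) auto
    with f2 show "(\<Sum>S\<in>Pow {..<n} - {{}}. (fourier n f S)\<^sup>2) \<le> 1" by linarith
  qed (use \<theta> in auto)
  finally show ?thesis by simp
qed

lemma gauge_gamma_eq:
  assumes "0 \<le> \<epsilon>" "\<epsilon> \<le> 1"
  shows "gauge_gamma n A \<epsilon> \<delta> = cube_mean n (\<lambda>x. of_bool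
    (\<bar>noise_op n (1 - 2 * \<epsilon>) (indicator A) x - cube_mean n (indicator A)\<bar> > \<delta>))"
  unfolding gauge_gamma_def prob_unif[of n "{x \<in> cube n. _ x}"] prob_noise[OF assms] prob_unif[of n A]
  by (rule cube_mean_cong) simp

lemma gauge_gamma_antimono: "\<delta> \<le> \<delta>' \<Longrightarrow> gauge_gamma n A \<epsilon> \<delta>' \<le> gauge_gamma n A \<epsilon> \<delta>"
  unfolding gauge_gamma_def by (intro measure_pmf.finite_measure_mono) auto

text \<open>Needed for \<open>Inf\<close> to be meaningful; 2 exceeds every probability.\<close>

lemma gauge_set_nonempty: "{\<delta>. \<delta> > 0 \<and> gauge_gamma n A \<epsilon> \<delta> < \<delta>} \<noteq> {}"
proof -
  have "gauge_gamma n A \<epsilon> 2 \<le> 1" by (simp add: gauge_gamma_def)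
  then have "2 \<in> {\<delta>. \<delta> > 0 \<and> gauge_gamma n A \<epsilon> \<delta> < \<delta>}" by simp
  then show ?thesis by blast
qed

lemma gauge_phi_nonneg: "0 \<le> gauge_phi n A \<epsilon>"
  unfolding gauge_phi_def by (rule cInf_greatest[OF gauge_set_nonempty]) simp

lemma gauge_phi_le:
  assumes "\<delta> > 0" "gauge_gamma n A \<epsilon> \<delta> < \<delta>"
  shows "gauge_phi n A \<epsilon> \<le> \<delta>"
  unfolding gauge_phi_def by (rule cInf_lower) (use assms in \<open>auto intro: bdd_belowI[of _ 0]\<close>)

text \<open>\<open>gauge_gamma\<close> decreases in its threshold, so the set defining the infimum
  is upward closed.\<close>

lemma gauge_gamma_less:
  assumes "gauge_phi n A \<epsilon> < \<delta>"
  shows "gauge_gamma n A \<epsilon> \<delta> < \<delta>"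
proof -
  obtain \<delta>' where "gauge_gamma n A \<epsilon> \<delta>' < \<delta>'" "\<delta>' < \<delta>"
    using cInf_lessD[OF gauge_set_nonempty assms[unfolded gauge_phi_def]] by blast
  then show ?thesis
    using gauge_gamma_antimono[of \<delta>' \<delta> n A \<epsilon>] by linarith
qed

text \<open>The deviation is a difference of two probabilities: at most 1 on the exceptional event
  and at most \<open>\<delta>\<close> off it.\<close>

lemma L1_deviation_le_gauge:
  assumes "0 \<le> \<epsilon>" "\<epsilon> \<le> 1" "0 \<le> \<delta>"
  shows "cube_mean n (\<lambda>x. \<bar>noise_op n (1 - 2 * \<epsilon>) (indicator A) x - cube_mean n (indicator A)\<bar>)
    \<le> \<delta> + gauge_gamma n A \<epsilon> \<delta>"
proof -
  let ?d = "\<lambda>x. \<bar>noise_op n (1 - 2 * \<epsilon>) (indicator A) x - cube_mean n (indicator A)\<bar>"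
  have "?d x \<le> 1" for x
    using measure_pmf.prob_le_1[of "noise n \<epsilon> x" A] measure_pmf.prob_le_1[of "unif n" A]
      measure_nonneg[of "measure_pmf (noise n \<epsilon> x)" A] measure_nonneg[of "measure_pmf (unif n)" A]
    unfolding prob_noise[OF assms(1,2)] prob_unif by linarith
  then have "cube_mean n ?d \<le> cube_mean n (\<lambda>x. \<delta> + of_bool (?d x > \<delta>))"
    using assms(3) by (intro cube_mean_mono) (simp add: add_increasing)
  then show ?thesis
    by (simp only: cube_mean_add cube_mean_const gauge_gamma_eq[OF assms(1,2)])
qed

lemma gauge_gamma_Chebyshev:
  assumes "0 \<le> \<epsilon>" "\<epsilon> \<le> 1" "0 \<le> \<delta>"
  shows "\<delta>\<^sup>2 * gauge_gamma n A \<epsilon> \<delta>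
    \<le> cube_mean n (\<lambda>x. (noise_op n (1 - 2 * \<epsilon>) (indicator A) x - cube_mean n (indicator A))\<^sup>2)"
proof -
  let ?d = "\<lambda>x. noise_op n (1 - 2 * \<epsilon>) (indicator A) x - cube_mean n (indicator A)"
  have "\<delta>\<^sup>2 * of_bool (\<bar>?d x\<bar> > \<delta>) \<le> (?d x)\<^sup>2" for x
    using power_mono[of \<delta> "\<bar>?d x\<bar>" 2] assms(3) by auto
  then have "cube_mean n (\<lambda>x. \<delta>\<^sup>2 * of_bool (\<bar>?d x\<bar> > \<delta>)) \<le> cube_mean n (\<lambda>x. (?d x)\<^sup>2)"
    by (intro cube_mean_mono)
  then show ?thesis
    by (simp only: cube_mean_cmult gauge_gamma_eq[OF assms(1,2)])
qed

lemma Lambda_tilde_nonneg: "0 \<le> Lambda_tilde n A"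
  using order_trans[OF abs_ge_zero Lambda_tilde_ge[of n "\<lambda>_. 0" A]] by simp

text \<open>One \<open>\<delta>\<close> bounds the typical deviation, the other the exceptional
  probability; the last term is the instability of majorities at rate \<open>1 / m\<close>.\<close>

lemma Lambda_tilde_le_gauge:
  assumes "m > 2" "gauge_phi n A (1 / real m) < \<delta>"
  shows "Lambda_tilde n A \<le> 2 * \<delta> + 2 / sqrt (real m)"
proof (rule Lambda_tilde_le)
  fix w
  have \<epsilon>: "0 \<le> 1 / real m" "1 / real m \<le> 1" using assms(1) by auto
  have "0 \<le> \<delta>" using assms(2) gauge_phi_nonneg[of n A "1 / real m"] by linarith
  note L1_deviation_le_gauge[OF \<epsilon> this, of n A]
  moreover have "\<bar>cube_mean n (\<lambda>x. indicator A x * weighted_majority n w x)\<bar>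
      \<le> cube_mean n (\<lambda>x. \<bar>noise_op n (1 - 2 / real m) (indicator A) x - cube_mean n (indicator A)\<bar>)
        + 2 / sqrt (real m)"
    using assms(1) by (intro weighted_majority_correlation_le) (auto simp: indicator_def)
  moreover have "gauge_gamma n A (1 / real m) \<delta> < \<delta>"
    by (rule gauge_gamma_less[OF assms(2)])
  ultimately show "\<bar>cube_mean n (\<lambda>x. indicator A x * weighted_majority n w x)\<bar>
      \<le> 2 * \<delta> + 2 / sqrt (real m)"
    by simp
qed

text \<open>The cube of \<open>\<delta>\<close> combines the square from Chebyshev with the bound
  \<open>\<delta>\<close> required of the probability.\<close>

lemma gauge_phi_le_Lambda_tilde:
  assumes mono: "monotone_event n A" and \<epsilon>: "0 \<le> \<epsilon>" "\<epsilon> \<le> 1 / 2" and \<delta>: "\<delta> > 0"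
    and small: "3 ^ k * sqrt (8 / 3 * Lambda_tilde n A + (Lambda_tilde n A)\<^sup>2) + (1 - 2 * \<epsilon>) ^ k < \<delta> ^ 3"
  shows "gauge_phi n A \<epsilon> \<le> \<delta>"
proof (rule gauge_phi_le[OF \<delta>])
  let ?f = "indicator A :: _ \<Rightarrow> real"
  have f: "monotone_fun n ?f" using mono by (simp add: monotone_event_def)
  have f01: "0 \<le> ?f x \<and> ?f x \<le> 1" for x by (simp add: indicator_def)
  have "\<delta>\<^sup>2 * gauge_gamma n A \<epsilon> \<delta>
      \<le> cube_mean n (\<lambda>x. (noise_op n (1 - 2 * \<epsilon>) ?f x - cube_mean n ?f)\<^sup>2)"
    using \<epsilon> \<delta> by (intro gauge_gamma_Chebyshev) auto
  also have "\<dots> \<le> 3 ^ k * sqrt (\<Sum>j<n. (fourier n ?f {j})\<^sup>2) + (1 - 2 * \<epsilon>) ^ k"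
    using \<epsilon> by (intro noise_op_deviation_le f f01) auto
  also have "\<dots> \<le> 3 ^ k * sqrt (8 / 3 * Lambda_tilde n A + (Lambda_tilde n A)\<^sup>2) + (1 - 2 * \<epsilon>) ^ k"
    by (intro add_right_mono mult_left_mono real_sqrt_le_mono sum_fourier_singleton_le f f01
      Lambda_tilde_ge) auto
  also have "\<dots> < \<delta>\<^sup>2 * \<delta>" using small by (simp add: power3_eq_cube power2_eq_square)
  finally show "gauge_gamma n A \<epsilon> \<delta> < \<delta>"
    using \<delta> by simp
qed

theorem theorem1p7:
  fixes n :: "nat \<Rightarrow> nat" and A :: "nat \<Rightarrow> (nat \<Rightarrow> bool) set"
  assumes "\<And>m. monotone_event (n m) (A m)"
  shows "asymptotically_noise_sensitive n A \<longleftrightarrow>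
           (\<lambda>m. Lambda_tilde (n m) (A m)) \<longlonglongrightarrow> 0"
proof
  assume sens: "asymptotically_noise_sensitive n A"
  show "(\<lambda>m. Lambda_tilde (n m) (A m)) \<longlonglongrightarrow> 0"
  proof (rule LIMSEQ_I)
    fix e :: real assume e: "e > 0"
    \<comment> \<open>One fixed noise rate \<open>1 / N\<close> suffices: stability costs less than
      \<open>e / 2\<close>, and a gauge below \<open>e / 4\<close> enters twice.
      \<open>N > 2\<close> puts the rate below 1/2.\<close>
    have "(\<lambda>N. 2 / sqrt (real N)) \<longlonglongrightarrow> 0"
      by real_asymp
    then have "\<forall>\<^sub>F N in sequentially. 2 / sqrt (real N) < e / 2"
      using e by (intro order_tendstoD) auto
    then have "\<forall>\<^sub>F N in sequentially. 2 / sqrt (real N) < e / 2 \<and> N > 2"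
      using eventually_gt_at_top by (rule eventually_conj)
    then obtain N where N: "2 / sqrt (real N) < e / 2" "N > 2"
      by (auto simp: eventually_sequentially)
    then have "1 / real N \<in> {0<..<1 / 2}" by (simp add: field_simps)
    with sens have "(\<lambda>m. gauge_phi (n m) (A m) (1 / real N)) \<longlonglongrightarrow> 0"
      unfolding asymptotically_noise_sensitive_def by blast
    then have "\<forall>\<^sub>F m in sequentially. gauge_phi (n m) (A m) (1 / real N) < e / 4"
      using e by (intro order_tendstoD) auto
    then have "\<forall>\<^sub>F m in sequentially. norm (Lambda_tilde (n m) (A m) - 0) < e"
    proof eventually_elim
      case (elim m)
      with N Lambda_tilde_le_gauge[OF N(2) elim] Lambda_tilde_nonneg[of "n m" "A m"]
      show ?case by simp
    qed
    then show "\<exists>M. \<forall>m\<ge>M. norm (Lambda_tilde (n m) (A m) - 0) < e"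
      by (simp add: eventually_sequentially)
  qed
next
  assume lim: "(\<lambda>m. Lambda_tilde (n m) (A m)) \<longlonglongrightarrow> 0"
  show "asymptotically_noise_sensitive n A"
    unfolding asymptotically_noise_sensitive_def
  proof (intro ballI LIMSEQ_I)
    fix \<epsilon> e :: real assume \<epsilon>: "\<epsilon> \<in> {0<..<1 / 2}" and e: "e > 0"
    define \<delta> where "\<delta> = e / 2"
    have \<delta>: "\<delta> > 0" using e by (simp add: \<delta>_def)
    \<comment> \<open>The level \<open>k\<close> depends only on \<open>\<epsilon>\<close> and
      \<open>\<delta>\<close>, so \<open>3 ^ k\<close> stays fixed while \<open>Lambda_tilde\<close>
      tends to 0.\<close>
    obtain k where k: "(1 - 2 * \<epsilon>) ^ k < \<delta> ^ 3"
      using real_arch_pow_inv[of "\<delta> ^ 3" "1 - 2 * \<epsilon>"] \<epsilon> \<delta> by auto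
    have "(\<lambda>m. 3 ^ k * sqrt (8 / 3 * Lambda_tilde (n m) (A m) + (Lambda_tilde (n m) (A m))\<^sup>2)
        + (1 - 2 * \<epsilon>) ^ k) \<longlonglongrightarrow> 3 ^ k * sqrt (8 / 3 * 0 + 0\<^sup>2) + (1 - 2 * \<epsilon>) ^ k"
      by (intro tendsto_intros lim)
    then have "\<forall>\<^sub>F m in sequentially.
        3 ^ k * sqrt (8 / 3 * Lambda_tilde (n m) (A m) + (Lambda_tilde (n m) (A m))\<^sup>2)
          + (1 - 2 * \<epsilon>) ^ k < \<delta> ^ 3"
      by (rule order_tendstoD) (use k in simp)
    then have "\<forall>\<^sub>F m in sequentially. norm (gauge_phi (n m) (A m) \<epsilon> - 0) < e"
    proof eventually_elim
      case (elim m)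
      have "gauge_phi (n m) (A m) \<epsilon> \<le> \<delta>"
        using \<epsilon> by (intro gauge_phi_le_Lambda_tilde[OF assms _ _ \<delta> elim]) auto
      with gauge_phi_nonneg[of "n m" "A m" \<epsilon>] e show ?case
        by (simp add: \<delta>_def)
    qed
    then show "\<exists>M. \<forall>m\<ge>M. norm (gauge_phi (n m) (A m) \<epsilon> - 0) < e"
      by (simp add: eventually_sequentially)
  qed
qed

end
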